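(* Let $p$, $F$, $K$, $G$, $J$, $N$ be as in the context, and let $$J\cong\bigoplus_{i=1}^{p}\Big(\bigoplus_{j\in\mathfrak{K}_i}M_{i,j}\Big)$$ be any decomposition of $J$ into cyclic $\mathbb{F}_p[G]$-modules $M_{i,j}$ with $\dim_{\mathbb{F}_p}M_{i,j}=i$, where $\mathfrak{K}_i$ are index sets, $i\in\{1,\dots,p\}$. Let $\Upsilon(K)=1$ if $\xi_p\in N(K^\times)$ and $\Upsilon(K)=0$ otherwise (for $p=2$, $\xi_2=-1$). Then (cardinalities as cardinal numbers): (1) $|\mathfrak{K}_1|+1 = 2\Upsilon(K)+\dim_{\mathbb{F}_p}\big(F^\times/N(K^\times)\big)$; (2) if $p>2$ then $|\mathfrak{K}_2| = 1-\Upsilon(K)$; (3) if $3\le i\le p-1$ then $\mathfrak{K}_i=\emptyset$; (4) $|\mathfrak{K}_p| = \dim_{\mathbb{F}_p}N(J)$.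
   Context: Let $p$ be a prime and $F$ a field of characteristic different from $p$ containing a primitive $p$th root of unity $\xi_p$. Let $a\in F^\times\setminus F^{\times p}$ and $K=F(\sqrt[p]{a})$, a cyclic extension of degree $p$; $K^\times=K\setminus\{0\}$. Let $G=\mathrm{Gal}(K/F)=\langle\sigma\rangle$, where $\sigma(\sqrt[p]{a})/\sqrt[p]{a}=\xi_p$. Let $J=K^\times/K^{\times p}$, an $\mathbb{F}_p[G]$-module. Let $N=1+\sigma+\dots+\sigma^{p-1}\in\mathbb{F}_p[G]$, also viewed as the endomorphism of $J$ it induces; $N(J)$ is its image. $N(K^\times)\subseteq F^\times$ denotes the group of norms from $K$ to $F$. Every nonzero cyclic $\mathbb{F}_p[G]$-module has $\mathbb{F}_p$-dimension in $\{1,\dots,p\}$ and is determined up to isomorphism by its dimension. *)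

theory Defs
  imports Main "HOL-Computational_Algebra.Primes"
begin

text \<open>Setting: the field K is modelled as a whole type 'k of class field;
  F is a subfield of K given as a set; sigma is the generator of Gal(K/F).\<close>

definition is_subfield :: "'k::field set \<Rightarrow> bool" where
  "is_subfield L \<longleftrightarrow> 0 \<in> L \<and> 1 \<in> L \<and>
     (\<forall>x\<in>L. \<forall>y\<in>L. x + y \<in> L \<and> x * y \<in> L) \<and>
     (\<forall>x\<in>L. - x \<in> L \<and> inverse x \<in> L)"

definition primitive_root :: "nat \<Rightarrow> 'k::field \<Rightarrow> bool" where
  "primitive_root p z \<longleftrightarrow> z ^ p = 1 \<and> (\<forall>k. 1 \<le> k \<and> k < p \<longrightarrow> z ^ k \<noteq> 1)"

definition field_aut :: "('k::field \<Rightarrow> 'k) \<Rightarrow> bool" where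
  "field_aut s \<longleftrightarrow> bij s \<and> (\<forall>x y. s (x + y) = s x + s y \<and> s (x * y) = s x * s y)"

definition pth :: "nat \<Rightarrow> 'k::field set" where
  "pth p = {y ^ p | y. y \<noteq> 0}"

definition normK :: "nat \<Rightarrow> ('k::field \<Rightarrow> 'k) \<Rightarrow> 'k set" where
  "normK p s = {(\<Prod>k<p. (s ^^ k) x) | x. x \<noteq> 0}"

definition Upsilon :: "nat \<Rightarrow> ('k::field \<Rightarrow> 'k) \<Rightarrow> 'k \<Rightarrow> nat" where
  "Upsilon p s xi = (if xi \<in> normK p s then 1 else 0)"

text \<open>F_p-vector spaces written multiplicatively: U/H with U a multiplicative group,
  H a subgroup with U^p \<subseteq> H. B \<subseteq> U is a set of representatives of an F_p-basis
  of U/H (spanning + linear independence, exponents in {0..p-1} as F_p-scalars).\<close>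
definition Fp_basis :: "nat \<Rightarrow> 'k::field set \<Rightarrow> 'k set \<Rightarrow> 'k set \<Rightarrow> bool" where
  "Fp_basis p U H B \<longleftrightarrow> B \<subseteq> U \<and>
     (\<forall>u\<in>U. \<exists>S e h. finite S \<and> S \<subseteq> B \<and> h \<in> H \<and> u = h * (\<Prod>b\<in>S. b ^ e b)) \<and>
     (\<forall>S (e :: 'k \<Rightarrow> nat). finite S \<and> S \<subseteq> B \<and> (\<forall>b\<in>S. e b < p) \<and> (\<Prod>b\<in>S. b ^ e b) \<in> H
        \<longrightarrow> (\<forall>b\<in>S. e b = 0))"

text \<open>Submodules of J = K^\<times>/K^{\<times>p} are represented by their preimages in K^\<times>.
  The cyclic F_p[G]-submodule of J generated by the class of g:\<close>
definition cycsub :: "nat \<Rightarrow> ('k::field \<Rightarrow> 'k) \<Rightarrow> 'k \<Rightarrow> 'k set" where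
  "cycsub p s g = {y ^ p * (\<Prod>k<p. ((s ^^ k) g) ^ (e k)) | y e. y \<noteq> 0}"

text \<open>Preimage in K^\<times> of N(J), where N = 1 + sigma + ... + sigma^(p-1) acting on J.\<close>
definition normJ_pre :: "nat \<Rightarrow> ('k::field \<Rightarrow> 'k) \<Rightarrow> 'k set" where
  "normJ_pre p s = {(\<Prod>k<p. (s ^^ k) x) * y ^ p | x y. x \<noteq> 0 \<and> y \<noteq> 0}"

definition Jdecomp :: "nat \<Rightarrow> ('k::field \<Rightarrow> 'k) \<Rightarrow> (nat \<Rightarrow> 'j set) \<Rightarrow> (nat \<Rightarrow> 'j \<Rightarrow> 'k set) \<Rightarrow> bool" where
  "Jdecomp p s Kset M \<longleftrightarrow>
     (\<forall>i\<in>{1..p}. \<forall>j\<in>Kset i.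
        (\<exists>g. g \<noteq> 0 \<and> M i j = cycsub p s g) \<and>
        (\<exists>B. finite B \<and> card B = i \<and> Fp_basis p (M i j) (pth p) B)) \<and>
     (\<forall>x. x \<noteq> 0 \<longrightarrow> (\<exists>S w y. finite S \<and> S \<subseteq> Sigma {1..p} Kset \<and> y \<noteq> 0 \<and>
        (\<forall>ij\<in>S. w ij \<in> M (fst ij) (snd ij)) \<and> x = y ^ p * (\<Prod>ij\<in>S. w ij))) \<and>
     (\<forall>S w. finite S \<and> S \<subseteq> Sigma {1..p} Kset \<and> (\<forall>ij\<in>S. w ij \<in> M (fst ij) (snd ij)) \<and>
        (\<Prod>ij\<in>S. w ij) \<in> pth p \<longrightarrow> (\<forall>ij\<in>S. w ij \<in> pth p))"

end

theory Submission
  imports Defs "HOL-Library.Equipollence"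
begin

text \<open>
  Write \<open>\<tau> = \<sigma> - 1\<close>, acting on \<open>K\<^sup>\<times>\<close> as \<open>x \<mapsto> \<sigma> x / x\<close>, and let \<open>V k\<close> be the preimage in
  \<open>K\<^sup>\<times>\<close> of \<open>\<tau>\<^sup>k J \<inter> ker \<tau>\<close>. A cyclic module of dimension \<open>i\<close> with generator \<open>g\<close> has the
  one-dimensional socle spanned by \<open>\<tau> ^ (i - 1) g\<close>, so in any decomposition the summands of dimension
  \<open>k + 1\<close> are counted by the dimension of \<open>V k / V (k + 1)\<close>. It remains to compute the filtration.
  Since \<open>N = \<tau> ^ (p - 1)\<close> modulo \<open>p\<close>, \<open>V (p - 1)\<close> is \<open>N(J)\<close>. For odd \<open>p\<close>, if \<open>u\<close> has norm 1 and
  \<open>\<tau> u = y ^ p\<close>, then \<open>N y\<close> is a \<open>p\<close>-th root of unity; as \<open>z ^ p / N z = \<tau> v\<close> for an explicit \<open>v\<close> whose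
  norm is a \<open>p\<close>-th power in \<open>F\<close>, a nontrivial value of \<open>N y\<close> would make \<open>a\<close> a \<open>p\<close>-th power in \<open>F\<close>. Now Hilbert 90
  yields \<open>V 1 = \<langle>\<xi>\<rangle> N(K\<^sup>\<times>) K\<^sup>\<times>\<^sup>p\<close>, and the same computation one step
  higher gives \<open>V k = N(K\<^sup>\<times>) K\<^sup>\<times>\<^sup>p\<close> for \<open>2 \<le> k < p\<close>; for \<open>p = 2\<close> both formulas agree, as \<open>-a\<close> is a norm. Finally \<open>V 0\<close> is \<open>F\<^sup>\<times> K\<^sup>\<times>\<^sup>p\<close>,
  enlarged by one dimension exactly when \<open>\<xi>\<close> is a norm.
\<close>

unbundle cardinal_syntax

section \<open>Dimension in pregeometries\<close>

text \<open>By induction on the cardinality: a subset with \<open>n + 1\<close> elements arises from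
  a point of \<open>B\<close> and a subset with \<open>n\<close> elements. The countable union over
  \<open>n\<close> keeps the bound.\<close>

lemma finite_subsets_ordLeq_infinite:
  assumes "infinite B"
  shows "|{A. A \<subseteq> B \<and> finite A}| \<le>o |B|"
proof -
  let ?S = "\<lambda>n. {A. A \<subseteq> B \<and> finite A \<and> card A = n}"
  have step: "|?S n| \<le>o |B|" for n
  proof (induction n)
    case 0
    have "?S 0 = {{}}" by auto
    then show ?case
      using assms by (simp add: card_of_singl_ordLeq infinite_imp_nonempty)
  next
    case (Suc n)
    have "?S (Suc n) \<subseteq> (\<lambda>(x, A). insert x A) ` (B \<times> ?S n)"
    proof
      fix A assume A: "A \<in> ?S (Suc n)"
      then obtain x where x: "x \<in> A" by fastforce
      have "A = (\<lambda>(x, A). insert x A) (x, A - {x})" using x by auto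
      moreover have "(x, A - {x}) \<in> B \<times> ?S n" using A x by auto
      ultimately show "A \<in> (\<lambda>(x, A). insert x A) ` (B \<times> ?S n)" by blast
    qed
    then have "|?S (Suc n)| \<le>o |B \<times> ?S n|"
      by (meson card_of_image card_of_mono1 ordLeq_transitive)
    also have "|B \<times> ?S n| \<le>o |B|"
      using Suc.IH assms by (intro card_of_Sigma_ordLeq_infinite) (auto intro: card_of_mono1)
    finally show ?case .
  qed
  have "{A. A \<subseteq> B \<and> finite A} = (\<Union>n. ?S n)" by auto
  moreover have "|\<Union>n. ?S n| \<le>o |B|"
    using assms step by (intro card_of_UNION_ordLeq_infinite) (auto simp: infinite_iff_card_of_nat)
  ultimately show ?thesis by simp
qed

text \<open>Abstracts linear span to what Steinitz exchange uses, so that dimensions of any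
  cardinality can be compared without making \<open>U/H\<close> a vector space type.\<close>

locale pregeometry =
  fixes U :: "'a set" and cl :: "'a set \<Rightarrow> 'a set"
  assumes cl_increasing: "A \<subseteq> U \<Longrightarrow> A \<subseteq> cl A"
    and cl_least: "A \<subseteq> U \<Longrightarrow> B \<subseteq> U \<Longrightarrow> A \<subseteq> cl B \<Longrightarrow> cl A \<subseteq> cl B"
    and cl_exchange: "A \<subseteq> U \<Longrightarrow> x \<in> U \<Longrightarrow> y \<in> cl (insert x A) \<Longrightarrow> y \<notin> cl A \<Longrightarrow> x \<in> cl (insert y A)"
    and cl_finitary: "A \<subseteq> U \<Longrightarrow> x \<in> cl A \<Longrightarrow> \<exists>S. finite S \<and> S \<subseteq> A \<and> x \<in> cl S"
begin

definition indep :: "'a set \<Rightarrow> bool" where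
  "indep A \<longleftrightarrow> A \<subseteq> U \<and> (\<forall>x\<in>A. x \<notin> cl (A - {x}))"

lemma cl_mono: "B \<subseteq> U \<Longrightarrow> A \<subseteq> B \<Longrightarrow> cl A \<subseteq> cl B"
  by (rule cl_least[OF _ _ order_trans[OF _ cl_increasing]]) auto

lemma indep_subset: "indep A \<Longrightarrow> B \<subseteq> A \<Longrightarrow> indep B"
  unfolding indep_def using cl_mono[of "A - {x}" "B - {x}" for x] by blast

lemma indep_insert:
  assumes "indep A" "y \<in> U" "y \<notin> cl A"
  shows "indep (insert y A)"
  unfolding indep_def
proof (intro conjI ballI)
  have AU: "A \<subseteq> U" using assms(1) by (simp add: indep_def)
  then show "insert y A \<subseteq> U" using assms(2) by simp
  have yA: "y \<notin> A" using assms(3) AU cl_increasing by blast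
  fix z assume z: "z \<in> insert y A"
  show "z \<notin> cl (insert y A - {z})"
  proof (cases "z = y")
    case True
    then show ?thesis using yA assms(3) by simp
  next
    case False
    then have zA: "z \<in> A" using z by simp
    have eq: "insert y A - {z} = insert y (A - {z})" using False by auto
    show ?thesis
    proof
      assume "z \<in> cl (insert y A - {z})"
      then have "y \<in> cl (insert z (A - {z}))"
        using cl_exchange[of "A - {z}" y z] AU assms(1,2) zA unfolding eq indep_def by blast
      then show False using assms(3) zA by (simp add: insert_absorb)
    qed
  qed
qed

text \<open>Steinitz exchange, by induction on the number of points of \<open>I\<close> outside
  \<open>B\<close>. Such a point \<open>x\<close> is traded for some \<open>y\<close> in
  \<open>B\<close> outside \<open>cl (I - {x})\<close>; it exists because otherwise
  \<open>cl B\<close>, and with it \<open>x\<close>, would lie in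
  \<open>cl (I - {x})\<close>.\<close>

lemma indep_card_le_finite:
  assumes "finite I" "indep I" "finite B" "B \<subseteq> U" "I \<subseteq> cl B"
  shows "card I \<le> card B"
  using assms
proof (induction "card (I - B)" arbitrary: I rule: less_induct)
  case less
  show ?case
  proof (cases "I \<subseteq> B")
    case True
    then show ?thesis using less.prems(3) by (rule card_mono[rotated])
  next
    case False
    then obtain x where x: "x \<in> I" "x \<notin> B" by blast
    have IU: "I \<subseteq> U" and xc: "x \<notin> cl (I - {x})" using less.prems(2) x by (auto simp: indep_def)
    have "\<not> B \<subseteq> cl (I - {x})"
      using cl_least[of B "I - {x}"] less.prems(4,5) IU x(1) xc by blast
    then obtain y where y: "y \<in> B" "y \<notin> cl (I - {x})" by blast
    have yI: "y \<notin> I - {x}" using y(2) cl_increasing[of "I - {x}"] IU by blast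
    define J where "J = insert y (I - {x})"
    have "indep J" unfolding J_def
      using indep_insert indep_subset less.prems(2,4) y by blast
    moreover have "card (J - B) < card (I - B)"
      using x y(1) less.prems(1) unfolding J_def
      by (intro psubset_card_mono) auto
    moreover have "J \<subseteq> cl B"
      using less.prems(4,5) y(1) cl_increasing[of B] unfolding J_def by blast
    moreover have "finite J" using less.prems(1) by (simp add: J_def)
    ultimately have "card J \<le> card B" using less.hyps less.prems(3,4) by blast
    moreover have "card J = card I"
      using yI x(1) less.prems(1) unfolding J_def by (simp add: card_Suc_Diff1 del: card_Diff_insert)
    ultimately show ?thesis by simp
  qed
qed

lemma indep_finite:
  assumes "indep I" "finite B" "B \<subseteq> U" "I \<subseteq> cl B"
  shows "finite I"
proof (rule ccontr)
  assume "infinite I"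
  then obtain J where J: "finite J" "J \<subseteq> I" "card J = Suc (card B)"
    using infinite_arbitrarily_large by blast
  then have "card J \<le> card B"
    using indep_card_le_finite[of J B] indep_subset assms by blast
  then show False using J(3) by simp
qed

text \<open>For infinite \<open>B\<close>, each point of \<open>I\<close> lies in the closure of a
  finite subset of \<open>B\<close>. By the finite case each such closure holds finitely many points
  of \<open>I\<close>, and there are at most \<open>|B|\<close> finite subsets.\<close>

lemma indep_ordLeq_spanning:
  assumes "indep I" "B \<subseteq> U" "I \<subseteq> cl B"
  shows "|I| \<le>o |B|"
proof (cases "finite B")
  case True
  then show ?thesis
    using indep_card_le_finite[of I B] indep_finite[of I B] assms
    by (simp add: card_of_ordLeq[symmetric] inj_on_iff_card_le)
next
  case False
  let ?S = "{S. S \<subseteq> B \<and> finite S}"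
  have "I \<subseteq> (\<Union>S\<in>?S. I \<inter> cl S)"
  proof
    fix x assume "x \<in> I"
    then obtain S where "finite S" "S \<subseteq> B" "x \<in> cl S"
      using cl_finitary[OF assms(2)] assms(3) by blast
    then show "x \<in> (\<Union>S\<in>?S. I \<inter> cl S)" using \<open>x \<in> I\<close> by blast
  qed
  then have "|I| \<le>o |\<Union>S\<in>?S. I \<inter> cl S|" by (rule card_of_mono1)
  also have "|\<Union>S\<in>?S. I \<inter> cl S| \<le>o |B|"
  proof (rule card_of_UNION_ordLeq_infinite[OF False finite_subsets_ordLeq_infinite[OF False]], safe)
    fix S assume S: "S \<subseteq> B" "finite S"
    have "finite (I \<inter> cl S)"
      using indep_finite[of "I \<inter> cl S" S] indep_subset assms(1,2) S by blast
    then show "|I \<inter> cl S| \<le>o |B|"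
      using False ordLess_imp_ordLeq[OF finite_ordLess_infinite[OF card_of_Well_order card_of_Well_order]]
      by (simp add: Field_card_of)
  qed
  finally show ?thesis .
qed

lemma bases_eqpoll:
  assumes "indep A" "U \<subseteq> cl A" "indep B" "U \<subseteq> cl B"
  shows "A \<approx> B"
proof -
  have "|A| \<le>o |B|" "|B| \<le>o |A|"
    using assms indep_ordLeq_spanning[of A B] indep_ordLeq_spanning[of B A] by (auto simp: indep_def)
  then show ?thesis by (simp add: eqpoll_iff_card_of_ordIso ordIso_iff_ordLeq)
qed

end

section \<open>Vector spaces over the prime field as quotients of multiplicative groups\<close>

definition mult_subgroup :: "'k::field set \<Rightarrow> bool" where
  "mult_subgroup G \<longleftrightarrow> 1 \<in> G \<and> 0 \<notin> G \<and> (\<forall>x\<in>G. \<forall>y\<in>G. x * y \<in> G) \<and> (\<forall>x\<in>G. inverse x \<in> G)"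

lemma mult_subgroupD:
  assumes "mult_subgroup G"
  shows "1 \<in> G" "x \<in> G \<Longrightarrow> x \<noteq> 0" "x \<in> G \<Longrightarrow> y \<in> G \<Longrightarrow> x * y \<in> G" "x \<in> G \<Longrightarrow> inverse x \<in> G"
    "x \<in> G \<Longrightarrow> y \<in> G \<Longrightarrow> x / y \<in> G"
  using assms unfolding mult_subgroup_def divide_inverse by auto

lemma mult_subgroup_power: "mult_subgroup G \<Longrightarrow> x \<in> G \<Longrightarrow> x ^ n \<in> G"
  by (induction n) (auto simp: mult_subgroupD)

lemma mult_subgroup_prod:
  assumes "mult_subgroup G" "\<And>i. i \<in> T \<Longrightarrow> f i \<in> G"
  shows "prod f T \<in> G"
  using assms(2)
  by (induction T rule: infinite_finite_induct) (auto simp: mult_subgroupD[OF assms(1)])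

lemma mult_subgroup_cancel_left:
  assumes "mult_subgroup G" "x \<in> G" "x * y \<in> G"
  shows "y \<in> G"
proof -
  have "y = (x * y) / x" using mult_subgroupD(2)[OF assms(1,2)] by simp
  then show ?thesis using mult_subgroupD(5)[OF assms(1) assms(3,2)] by simp
qed

lemma mult_subgroup_vimage:
  fixes f :: "'k::field \<Rightarrow> 'k"
  assumes "mult_subgroup G" "\<And>x y. f (x * y) = f x * f y" "\<And>x. f (inverse x) = inverse (f x)" "f 1 = 1"
  shows "mult_subgroup {x. x \<noteq> 0 \<and> f x \<in> G}"
  using mult_subgroupD[OF assms(1)] assms(2-4) unfolding mult_subgroup_def by auto

text \<open>Natural exponents give a group once the p-th powers of the family lie in
  \<open>H\<close>: the exponent \<open>p - 1\<close> then provides inverses.\<close>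

definition mspan :: "'k::field set \<Rightarrow> 'i set \<Rightarrow> ('i \<Rightarrow> 'k) \<Rightarrow> 'k set" where
  "mspan H I b = {h * (\<Prod>i\<in>T. b i ^ (e i :: nat)) | h T e. h \<in> H \<and> finite T \<and> T \<subseteq> I}"

lemma mspanI: "h \<in> H \<Longrightarrow> finite T \<Longrightarrow> T \<subseteq> I \<Longrightarrow> x = h * (\<Prod>i\<in>T. b i ^ e i) \<Longrightarrow> x \<in> mspan H I b"
  unfolding mspan_def by blast

lemma mspanE:
  assumes "x \<in> mspan H I b"
  obtains h T e where "h \<in> H" "finite T" "T \<subseteq> I" "x = h * (\<Prod>i\<in>T. b i ^ (e i :: nat))"
  using assms unfolding mspan_def by blast

text \<open>Indexed families let index sets such as \<open>Kset i\<close> be compared directly.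
  Exponents are unbounded, so a zero scalar of the prime field appears as divisibility by
  \<open>p\<close>.\<close>

definition fam_basis :: "nat \<Rightarrow> 'k::field set \<Rightarrow> 'k set \<Rightarrow> 'i set \<Rightarrow> ('i \<Rightarrow> 'k) \<Rightarrow> bool" where
  "fam_basis p U H I b \<longleftrightarrow> b ` I \<subseteq> U \<and> U \<subseteq> mspan H I b \<and>
     (\<forall>S e. finite S \<and> S \<subseteq> I \<and> (\<Prod>i\<in>S. b i ^ e i) \<in> H \<longrightarrow> (\<forall>i\<in>S. p dvd e i))"

lemma fam_basisD:
  assumes "fam_basis p U H I b"
  shows "i \<in> I \<Longrightarrow> b i \<in> U" "x \<in> U \<Longrightarrow> x \<in> mspan H I b"
    "finite S \<Longrightarrow> S \<subseteq> I \<Longrightarrow> (\<Prod>i\<in>S. b i ^ e i) \<in> H \<Longrightarrow> i \<in> S \<Longrightarrow> p dvd e i"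
proof -
  show "i \<in> I \<Longrightarrow> b i \<in> U" "x \<in> U \<Longrightarrow> x \<in> mspan H I b"
    using assms unfolding fam_basis_def by auto
  have "\<forall>S e. finite S \<and> S \<subseteq> I \<and> (\<Prod>i\<in>S. b i ^ e i) \<in> H \<longrightarrow> (\<forall>i\<in>S. p dvd e i)"
    using assms unfolding fam_basis_def by (elim conjE)
  from this[THEN spec, THEN spec, of S e]
  show "finite S \<Longrightarrow> S \<subseteq> I \<Longrightarrow> (\<Prod>i\<in>S. b i ^ e i) \<in> H \<Longrightarrow> i \<in> S \<Longrightarrow> p dvd e i"
    by simp
qed

section \<open>Groups \<open>U/H\<close> of exponent \<open>p\<close> and their spans\<close>

locale Fp_quotient =
  fixes p :: nat and U H :: "'k::field set"
  assumes prime_p: "prime p" and sub_U: "mult_subgroup U" and sub_H: "mult_subgroup H"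
    and H_U: "H \<subseteq> U" and pow_U: "\<And>u. u \<in> U \<Longrightarrow> u ^ p \<in> H"
begin

lemma pow_dvd_mem: "u \<in> U \<Longrightarrow> p dvd n \<Longrightarrow> u ^ n \<in> H"
  using pow_U sub_H by (auto simp: power_mult mult_subgroup_power elim!: dvdE)

lemma mspan_base: "H \<subseteq> mspan H I b"
  by (auto intro: mspanI[where T = "{}"])

lemma mspan_gen: "i \<in> I \<Longrightarrow> b i \<in> mspan H I b"
  using mult_subgroupD(1)[OF sub_H] by (auto intro: mspanI[where T = "{i}" and h = 1 and e = "\<lambda>_. 1"])

lemma mspan_least:
  assumes "mult_subgroup G" "H \<subseteq> G" "b ` I \<subseteq> G"
  shows "mspan H I b \<subseteq> G"
proof
  fix x assume "x \<in> mspan H I b"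
  then obtain h T e where *: "h \<in> H" "T \<subseteq> I" "x = h * (\<Prod>i\<in>T. b i ^ e i)" by (elim mspanE)
  have "(\<Prod>i\<in>T. b i ^ e i) \<in> G"
    using *(2) assms by (intro mult_subgroup_prod mult_subgroup_power) auto
  then show "x \<in> G" using * assms by (auto simp: mult_subgroupD)
qed

lemma mspan_carrier: "b ` I \<subseteq> U \<Longrightarrow> mspan H I b \<subseteq> U"
  by (rule mspan_least[OF sub_U H_U])

lemma mspan_subgroup:
  assumes "b ` I \<subseteq> U"
  shows "mult_subgroup (mspan H I b)"
  unfolding mult_subgroup_def
proof (intro conjI ballI)
  show "1 \<in> mspan H I b" using mspan_base mult_subgroupD(1)[OF sub_H] by blast
  show "0 \<notin> mspan H I b" using mspan_carrier[OF assms] mult_subgroupD(2)[OF sub_U] by blast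
next
  fix x y assume "x \<in> mspan H I b" "y \<in> mspan H I b"
  then obtain h T e h' T' e' where
    x: "h \<in> H" "finite T" "T \<subseteq> I" "x = h * (\<Prod>i\<in>T. b i ^ (e i::nat))" and
    y: "h' \<in> H" "finite T'" "T' \<subseteq> I" "y = h' * (\<Prod>i\<in>T'. b i ^ (e' i::nat))"
    by (elim mspanE) blast
  let ?e = "\<lambda>i. (if i \<in> T then e i else 0) + (if i \<in> T' then e' i else 0)"
  have "(\<Prod>i\<in>T \<union> T'. b i ^ ?e i) = (\<Prod>i\<in>T. b i ^ e i) * (\<Prod>i\<in>T'. b i ^ e' i)"
  proof -
    have "(\<Prod>i\<in>T. b i ^ e i) = (\<Prod>i\<in>T \<union> T'. b i ^ (if i \<in> T then e i else 0))"
      using x(2) y(2) by (intro prod.mono_neutral_cong_left) auto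
    moreover have "(\<Prod>i\<in>T'. b i ^ e' i) = (\<Prod>i\<in>T \<union> T'. b i ^ (if i \<in> T' then e' i else 0))"
      using x(2) y(2) by (intro prod.mono_neutral_cong_left) auto
    ultimately show ?thesis by (simp only: power_add prod.distrib)
  qed
  then show "x * y \<in> mspan H I b"
    using x y mult_subgroupD(3)[OF sub_H] by (intro mspanI[where h = "h * h'" and T = "T \<union> T'" and e = ?e]) auto
next
  fix x assume "x \<in> mspan H I b"
  then obtain h T e where x: "h \<in> H" "finite T" "T \<subseteq> I" "x = h * (\<Prod>i\<in>T. b i ^ (e i::nat))"
    by (elim mspanE)
  let ?q = "\<Prod>i\<in>T. b i ^ e i"
  have q: "?q \<in> U"
    using x(3) assms by (intro mult_subgroup_prod[OF sub_U] mult_subgroup_power[OF sub_U]) auto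
  have q0: "?q \<noteq> 0" using mult_subgroupD(2)[OF sub_U q] .
  \<comment> \<open>The inverse of \<open>?q\<close> is \<open>?q ^ (p - 1)\<close> up to the factor
    \<open>?q ^ p\<close>, which lies in \<open>H\<close>.\<close>
  have "inverse x = (inverse h * inverse (?q ^ p)) * (\<Prod>i\<in>T. b i ^ (e i * (p - 1)))"
  proof -
    have "?q * ?q ^ (p - 1) = ?q ^ p"
      using prime_gt_0_nat[OF prime_p] by (metis power_eq_if less_not_refl)
    then have "inverse ?q = inverse (?q ^ p) * ?q ^ (p - 1)" using q0 by (simp add: field_simps)
    moreover have "?q ^ (p - 1) = (\<Prod>i\<in>T. b i ^ (e i * (p - 1)))"
      by (simp add: prod_power_distrib power_mult)
    ultimately show ?thesis using x(4) by (simp add: mult.assoc)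
  qed
  moreover have "inverse h * inverse (?q ^ p) \<in> H"
    using x(1) q pow_U mult_subgroupD[OF sub_H] by blast
  ultimately show "inverse x \<in> mspan H I b" using x by (intro mspanI) auto
qed

lemma mspan_insertE:
  assumes "x \<in> mspan H (insert j I) b"
  obtains s n where "s \<in> mspan H I b" "x = s * b j ^ (n::nat)"
proof -
  obtain h T e where x: "h \<in> H" "finite T" "T \<subseteq> insert j I" "x = h * (\<Prod>i\<in>T. b i ^ (e i::nat))"
    using assms by (elim mspanE)
  define s where "s = h * (\<Prod>i\<in>T - {j}. b i ^ e i)"
  have s: "s \<in> mspan H I b" unfolding s_def using x by (intro mspanI) auto
  show ?thesis
  proof (cases "j \<in> T")
    case True
    then have "x = s * b j ^ e j" using x(2,4) unfolding s_def
      by (subst (asm) prod.remove[of T j]) (auto simp: mult_ac)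
    then show ?thesis using s that by blast
  next
    case False
    then have "x = s * b j ^ 0" using x(4) unfolding s_def by simp
    then show ?thesis using s that by blast
  qed
qed

text \<open>Division by a nonzero scalar of the prime field: Bezout gives
  \<open>n * u = p * v + 1\<close>, so \<open>x\<close> is a power of \<open>x ^ n\<close> up to a
  power of \<open>x ^ p\<close>, and \<open>x ^ p\<close> lies in \<open>H\<close>.\<close>

lemma root_mem:
  assumes "mult_subgroup G" "H \<subseteq> G" "x \<in> U" "x ^ n \<in> G" "\<not> p dvd n"
  shows "x \<in> G"
proof -
  have n0: "n \<noteq> 0" using assms(5) by (metis dvd_0_right)
  have "coprime n p" using assms(5) prime_p by (metis coprime_commute prime_imp_coprime)
  then obtain u v where "n * u = p * v + 1"
    using bezout_nat[OF n0, of p] by auto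
  then have "x ^ (n * u) = (x ^ p) ^ v * x" by (simp add: power_mult)
  moreover have "x ^ (n * u) \<in> G" using assms by (simp add: power_mult mult_subgroup_power)
  moreover have "(x ^ p) ^ v \<in> G" using pow_U assms by (meson mult_subgroup_power subsetD)
  ultimately show ?thesis using assms(1) mult_subgroup_cancel_left by metis
qed

section \<open>Span as a closure operator, and invariance of dimension\<close>

abbreviation cl :: "'k set \<Rightarrow> 'k set" where
  "cl A \<equiv> mspan H A (\<lambda>x. x)"

sublocale pregeometry U cl
proof
  fix A assume A: "A \<subseteq> U"
  show "A \<subseteq> cl A" using mspan_gen[of _ A "\<lambda>x. x"] by blast
next
  fix A B assume "A \<subseteq> U" "B \<subseteq> U" "A \<subseteq> cl B"
  then show "cl A \<subseteq> cl B" by (intro mspan_least mspan_subgroup mspan_base) auto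
next
  fix A x y assume A: "A \<subseteq> U" "x \<in> U" and y: "y \<in> cl (insert x A)" "y \<notin> cl A"
  obtain s n where s: "s \<in> cl A" "y = s * x ^ n" using y(1) by (elim mspan_insertE)
  have yU: "y \<in> U" using y(1) A mspan_carrier[of "\<lambda>x. x" "insert x A"] by auto
  have sub: "mult_subgroup (cl A)" "mult_subgroup (cl (insert y A))"
    using A yU by (auto intro!: mspan_subgroup)
  have "cl A \<subseteq> cl (insert y A)"
    using sub(2) mspan_base mspan_gen[of _ "insert y A" "\<lambda>x. x"] by (intro mspan_least) auto
  then have "s \<in> cl (insert y A)" using s(1) by blast
  moreover have "y \<in> cl (insert y A)" using mspan_gen[of y "insert y A" "\<lambda>x. x"] by simp
  ultimately have xn: "x ^ n \<in> cl (insert y A)" using s(2) sub(2) mult_subgroup_cancel_left by metis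
  \<comment> \<open>Otherwise \<open>x ^ n\<close> would lie in \<open>H\<close> and
    \<open>y\<close> already in \<open>cl A\<close>. Hence \<open>x\<close> can be recovered from
    \<open>x ^ n\<close>, which is the exchange property.\<close>
  have "\<not> p dvd n"
  proof
    assume "p dvd n"
    then have "x ^ n \<in> cl A" using pow_dvd_mem A(2) mspan_base by blast
    then show False using s y(2) sub(1) mult_subgroupD(3) by metis
  qed
  then show "x \<in> cl (insert y A)" using root_mem[OF sub(2) mspan_base A(2) xn] by blast
next
  fix A x assume "A \<subseteq> U" "x \<in> cl A"
  then obtain h T e where x: "h \<in> H" "finite T" "T \<subseteq> A" "x = h * (\<Prod>i\<in>T. i ^ (e i::nat))"
    by (elim mspanE)
  then have "x \<in> cl T" by (intro mspanI) auto
  then show "\<exists>S. finite S \<and> S \<subseteq> A \<and> x \<in> cl S" using x by blast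
qed

text \<open>Two equal members would give \<open>b i * b j ^ (p - 1) = b i ^ p\<close>, a relation
  modulo \<open>H\<close> with exponent 1 at \<open>i\<close>.\<close>

lemma fam_basis_inj:
  assumes "fam_basis p U H I b"
  shows "inj_on b I"
proof (rule inj_onI, rule ccontr)
  fix i j assume ij: "i \<in> I" "j \<in> I" "b i = b j" "i \<noteq> j"
  let ?e = "\<lambda>k. if k = i then 1 else p - 1"
  have "(\<Prod>k\<in>{i, j}. b k ^ ?e k) = b i * b i ^ (p - 1)" using ij by simp
  also have "\<dots> = b i ^ p"
    using prime_gt_0_nat[OF prime_p] by (metis power_eq_if less_not_refl)
  finally have "(\<Prod>k\<in>{i, j}. b k ^ ?e k) \<in> H"
    using pow_U fam_basisD(1)[OF assms ij(1)] by simp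
  then have "p dvd ?e i" using fam_basisD(3)[OF assms, of "{i, j}" ?e i] ij by blast
  then show False using prime_p not_prime_unit by auto
qed

lemma fam_basis_image:
  assumes "fam_basis p U H I b"
  shows "indep (b ` I)" "U \<subseteq> cl (b ` I)"
proof -
  have bU: "b ` I \<subseteq> U" and inj: "inj_on b I"
    using fam_basisD(1)[OF assms] fam_basis_inj[OF assms] by auto
  show "U \<subseteq> cl (b ` I)"
  proof -
    have "mspan H I b \<subseteq> cl (b ` I)"
      using mspan_gen[of _ "b ` I" "\<lambda>x. x"] bU by (intro mspan_least mspan_subgroup mspan_base) auto
    then show ?thesis using fam_basisD(2)[OF assms] by blast
  qed
  show "indep (b ` I)" unfolding indep_def
  proof (intro conjI bU ballI notI)
    fix x assume "x \<in> b ` I" and x: "x \<in> cl (b ` I - {x})"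
    then obtain j where j: "j \<in> I" "x = b j" by blast
    have sub: "mult_subgroup (mspan H (I - {j}) b)" using bU by (intro mspan_subgroup) auto
    have "cl (b ` I - {x}) \<subseteq> mspan H (I - {j}) b"
    proof (rule mspan_least[OF sub mspan_base])
      show "(\<lambda>x. x) ` (b ` I - {x}) \<subseteq> mspan H (I - {j}) b"
        using j(2) mspan_gen[of _ "I - {j}" b] by force
    qed
    then have "x \<in> mspan H (I - {j}) b" using x by blast
    \<comment> \<open>Expanding \<open>inverse x\<close> rather than \<open>x\<close> gives a
      relation with exponent 1 at \<open>j\<close> and no negative exponents.\<close>
    then have "inverse x \<in> mspan H (I - {j}) b" using mult_subgroupD(4)[OF sub] by blast
    then obtain h T e where *: "h \<in> H" "finite T" "T \<subseteq> I - {j}"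
      "inverse x = h * (\<Prod>i\<in>T. b i ^ (e i::nat))" by (elim mspanE)
    let ?e = "e(j := 1)"
    have jT: "j \<notin> T" using *(3) by blast
    have "(\<Prod>i\<in>T. b i ^ ?e i) = (\<Prod>i\<in>T. b i ^ e i)"
      using jT by (intro prod.cong) auto
    then have "h * (\<Prod>i\<in>insert j T. b i ^ ?e i) = x * inverse x"
      using jT *(2,4) j(2) by (simp add: mult_ac)
    also have "\<dots> = 1" using j bU mult_subgroupD(2)[OF sub_U] by auto
    finally have "(\<Prod>i\<in>insert j T. b i ^ ?e i) \<in> H"
      using mult_subgroup_cancel_left[OF sub_H *(1)] mult_subgroupD(1)[OF sub_H] by metis
    then have "p dvd ?e j"
      using fam_basisD(3)[OF assms, of "insert j T" ?e j] *(2,3) j(1) by blast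
    then show False using prime_p not_prime_unit by auto
  qed
qed

lemma fam_basis_eqpoll:
  assumes "fam_basis p U H I b" "fam_basis p U H J c"
  shows "I \<approx> J"
proof -
  have "b ` I \<approx> c ` J"
    using bases_eqpoll fam_basis_image[OF assms(1)] fam_basis_image[OF assms(2)] by blast
  then show ?thesis
    using fam_basis_inj[OF assms(1)] fam_basis_inj[OF assms(2)] by simp
qed

text \<open>\<open>Fp_basis\<close> tests exponents below \<open>p\<close>; a general relation is
  reduced to these by splitting off p-th powers, which lie in \<open>H\<close>.\<close>

lemma Fp_basis_fam_basis:
  assumes "Fp_basis p U H B"
  shows "fam_basis p U H B (\<lambda>x. x)"
  unfolding fam_basis_def
proof (intro conjI allI impI)
  have BU: "B \<subseteq> U" using assms by (simp add: Fp_basis_def)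
  then show "(\<lambda>x. x) ` B \<subseteq> U" by simp
  show "U \<subseteq> cl B"
  proof
    fix u assume "u \<in> U"
    then obtain S e h where "finite S" "S \<subseteq> B" "h \<in> H" "u = h * (\<Prod>b\<in>S. b ^ e b)"
      using assms unfolding Fp_basis_def by meson
    then show "u \<in> cl B" by (intro mspanI)
  qed
  fix S and e :: "'k \<Rightarrow> nat" assume S: "finite S \<and> S \<subseteq> B \<and> (\<Prod>i\<in>S. i ^ e i) \<in> H"
  let ?r = "\<lambda>b. e b mod p" and ?q = "\<lambda>b. e b div p"
  have "(\<Prod>b\<in>S. b ^ e b) = (\<Prod>b\<in>S. (b ^ p) ^ ?q b * b ^ ?r b)"
    by (intro prod.cong refl) (simp flip: power_mult power_add)
  then have eq: "(\<Prod>b\<in>S. b ^ e b) = (\<Prod>b\<in>S. (b ^ p) ^ ?q b) * (\<Prod>b\<in>S. b ^ ?r b)"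
    by (simp add: prod.distrib)
  have "(\<Prod>b\<in>S. (b ^ p) ^ ?q b) \<in> H"
    using S BU by (intro mult_subgroup_prod[OF sub_H] mult_subgroup_power[OF sub_H, of "b ^ p" for b] pow_U) auto
  then have "(\<Prod>b\<in>S. b ^ ?r b) \<in> H"
    using S mult_subgroup_cancel_left[OF sub_H] unfolding eq by blast
  moreover have "\<forall>b\<in>S. ?r b < p" using prime_gt_0_nat[OF prime_p] by simp
  ultimately have "\<forall>b\<in>S. ?r b = 0" using assms S unfolding Fp_basis_def by meson
  then show "\<forall>i\<in>S. p dvd e i" by (simp add: dvd_eq_mod_eq_0)
qed

text \<open>A relation with exponent \<open>n\<close> at the new index puts \<open>x ^ n\<close> in
  the span of the old members. As \<open>x\<close> is not in that span, \<open>p\<close> divides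
  \<open>n\<close>, and a relation among the old members remains.\<close>

lemma fam_basis_adjoin:
  assumes "b ` I \<subseteq> U" "x \<in> U" "x \<notin> mspan H I b"
    and span: "\<And>u. u \<in> U \<Longrightarrow> \<exists>s\<in>mspan H I b. \<exists>n::nat. u = s * x ^ n"
    and ind: "\<And>S e i. finite S \<Longrightarrow> S \<subseteq> I \<Longrightarrow> (\<Prod>i\<in>S. b i ^ e i) \<in> H \<Longrightarrow> i \<in> S \<Longrightarrow> p dvd e i"
  shows "fam_basis p U H (I <+> {()}) (case_sum b (\<lambda>_. x))"
  unfolding fam_basis_def
proof (intro conjI allI impI)
  let ?b = "case_sum b (\<lambda>_. x)" and ?I = "I <+> {()}"
  show bU: "?b ` ?I \<subseteq> U" using assms(1,2) by auto
  have G: "mult_subgroup (mspan H ?I ?b)" by (rule mspan_subgroup[OF bU])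
  have "b i \<in> mspan H ?I ?b" if "i \<in> I" for i
    using mspan_gen[of "Inl i" ?I ?b] that by auto
  then have sub: "mspan H I b \<subseteq> mspan H ?I ?b"
    by (intro mspan_least[OF G mspan_base]) auto
  have x: "x \<in> mspan H ?I ?b" using mspan_gen[of "Inr ()" ?I ?b] by auto
  show "U \<subseteq> mspan H ?I ?b"
  proof
    fix u assume "u \<in> U"
    then obtain s n where "s \<in> mspan H I b" "u = s * x ^ n" using span by blast
    then show "u \<in> mspan H ?I ?b"
      using sub mult_subgroupD(3)[OF G] mult_subgroup_power[OF G x] by blast
  qed
  fix S and e :: "_ \<Rightarrow> nat" assume S: "finite S \<and> S \<subseteq> ?I \<and> (\<Prod>i\<in>S. ?b i ^ e i) \<in> H"
  define A where "A = Inl -` S"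
  define n where "n = (if Inr () \<in> S then e (Inr ()) else 0)"
  have A: "finite A" "A \<subseteq> I" using S unfolding A_def by (auto intro: finite_vimageI)
  have S_eq: "S = A <+> (Inr -` S)"
  proof (rule set_eqI)
    fix i show "i \<in> S \<longleftrightarrow> i \<in> A <+> (Inr -` S)" by (cases i) (auto simp: A_def)
  qed
  have "(\<Prod>i\<in>S. ?b i ^ e i) = (\<Prod>i\<in>A. b i ^ e (Inl i)) * (\<Prod>i\<in>Inr -` S. x ^ e (Inr i))"
    using A(1) by (subst S_eq, subst prod.Plus) auto
  also have "(\<Prod>i\<in>Inr -` S. x ^ e (Inr i)) = x ^ n"
  proof (cases "Inr () \<in> S")
    case True
    then have "(Inr -` S :: unit set) = {()}" by auto
    then show ?thesis using True by (simp add: n_def)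
  next
    case False
    then have "(Inr -` S :: unit set) = {}" by auto
    then show ?thesis using False by (simp add: n_def)
  qed
  finally have H: "(\<Prod>i\<in>A. b i ^ e (Inl i)) * x ^ n \<in> H" using S by simp
  have subI: "mult_subgroup (mspan H I b)" by (rule mspan_subgroup[OF assms(1)])
  have "(\<Prod>i\<in>A. b i ^ e (Inl i)) \<in> mspan H I b"
    using A mult_subgroupD(1)[OF sub_H] by (intro mspanI[where h = 1 and T = A]) auto
  then have "x ^ n \<in> mspan H I b"
    using H mspan_base mult_subgroup_cancel_left[OF subI] by blast
  then have dvd: "p dvd n" using root_mem[OF subI mspan_base assms(2)] assms(3) by blast
  then have "(\<Prod>i\<in>A. b i ^ e (Inl i)) \<in> H"
    using H mult_subgroup_cancel_left[OF sub_H pow_dvd_mem[OF assms(2) dvd]] by (metis mult.commute)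
  then have dvdA: "p dvd e (Inl i)" if "i \<in> A" for i
    using ind[OF A, of "\<lambda>i. e (Inl i)" i] that by simp
  show "\<forall>i\<in>S. p dvd e i"
  proof
    fix i assume "i \<in> S"
    then show "p dvd e i" using dvdA dvd unfolding A_def n_def by (cases i) auto
  qed
qed

text \<open>Enlarging \<open>H\<close> by \<open>x\<close> lowers the dimension by one, and
  \<open>x\<close> itself restores it.\<close>

lemma fam_basis_quotient_adjoin:
  assumes "fam_basis p U {h * x ^ n | h n. h \<in> H} I b" "x \<in> U" "x \<notin> H"
  shows "fam_basis p U H (I <+> {()}) (case_sum b (\<lambda>_. x))"
proof (rule fam_basis_adjoin)
  let ?H = "{h * x ^ n | h n. h \<in> H}"
  have HH: "h \<in> H \<Longrightarrow> h \<in> ?H" for h by (rule CollectI, rule exI[of _ h], rule exI[of _ 0]) simp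
  show bU: "b ` I \<subseteq> U" using fam_basisD(1)[OF assms(1)] by blast
  show "x \<in> U" by fact
  show ind: "p dvd e i"
    if "finite S" "S \<subseteq> I" "(\<Prod>i\<in>S. b i ^ e i) \<in> H" "i \<in> S" for S e i
    using fam_basisD(3)[OF assms(1) that(1,2) HH[OF that(3)] that(4)] .
  show "\<exists>s\<in>mspan H I b. \<exists>n::nat. u = s * x ^ n" if uU: "u \<in> U" for u
  proof -
    obtain h T e where u: "h \<in> ?H" "finite T" "T \<subseteq> I" "u = h * (\<Prod>i\<in>T. b i ^ (e i::nat))"
      using fam_basisD(2)[OF assms(1) uU] by (elim mspanE)
    then obtain h' n where h: "h' \<in> H" "h = h' * x ^ n" by blast
    have "h' * (\<Prod>i\<in>T. b i ^ e i) \<in> mspan H I b" using h u by (intro mspanI) auto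
    moreover have "u = h' * (\<Prod>i\<in>T. b i ^ e i) * x ^ n" using u(4) h(2) by (simp add: mult_ac)
    ultimately show ?thesis by blast
  qed
  show "x \<notin> mspan H I b"
  proof
    assume "x \<in> mspan H I b"
    then obtain h T e where *: "h \<in> H" "finite T" "T \<subseteq> I" "x = h * (\<Prod>i\<in>T. b i ^ (e i::nat))"
      by (elim mspanE)
    have h0: "h \<noteq> 0" using mult_subgroupD(2)[OF sub_H *(1)] .
    then have "(\<Prod>i\<in>T. b i ^ e i) = inverse h * x ^ 1" using *(4) by simp
    \<comment> \<open>An expansion of \<open>x\<close> in the family is trivial modulo the enlarged
      group, so all its exponents are divisible by \<open>p\<close> and \<open>x\<close> would fall
      into \<open>H\<close>.\<close>
    then have "(\<Prod>i\<in>T. b i ^ e i) \<in> ?H" using mult_subgroupD(4)[OF sub_H *(1)] by blast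
    then have "p dvd e i" if "i \<in> T" for i using fam_basisD(3)[OF assms(1) *(2,3)] that by blast
    then have "(\<Prod>i\<in>T. b i ^ e i) \<in> H"
      using *(3) bU by (intro mult_subgroup_prod[OF sub_H] pow_dvd_mem) auto
    then show False using * assms(3) mult_subgroupD(3)[OF sub_H] by blast
  qed
qed

text \<open>The companion at the other end: \<open>V\<close> has codimension one in
  \<open>U\<close>, with \<open>x\<close> spanning a complement.\<close>

lemma fam_basis_subspace_adjoin:
  assumes "fam_basis p V H I b" "mult_subgroup V" "H \<subseteq> V" "V \<subseteq> U" "x \<in> U" "x \<notin> V"
    and "\<And>u. u \<in> U \<Longrightarrow> \<exists>v\<in>V. \<exists>n::nat. u = v * x ^ n"
  shows "fam_basis p U H (I <+> {()}) (case_sum b (\<lambda>_. x))"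
proof (rule fam_basis_adjoin)
  have bV: "b ` I \<subseteq> V" using fam_basisD(1)[OF assms(1)] by blast
  then show "b ` I \<subseteq> U" using assms(4) by blast
  show "x \<in> U" by fact
  have eq: "mspan H I b = V"
    using fam_basisD(2)[OF assms(1)] mspan_least[OF assms(2,3) bV] by blast
  show "x \<notin> mspan H I b" using assms(6) eq by simp
  show "\<exists>s\<in>mspan H I b. \<exists>n::nat. u = s * x ^ n" if "u \<in> U" for u
    using assms(7)[OF that] eq by simp
qed (rule fam_basisD(3)[OF assms(1)])

lemma fam_basis_empty_iff: "fam_basis p U H {} b \<longleftrightarrow> U = H"
proof -
  have "mspan H {} b = H" by (auto simp: mspan_def)
  then show ?thesis using H_U by (auto simp: fam_basis_def)
qed

text \<open>Only classes modulo \<open>H\<close> matter. This serves to move representatives into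
  \<open>F\<close>.\<close>

lemma fam_basis_change:
  assumes "fam_basis p U H I b" "\<And>i. i \<in> I \<Longrightarrow> f i \<in> U" "\<And>i. i \<in> I \<Longrightarrow> b i / f i \<in> H"
  shows "fam_basis p U H I f"
  unfolding fam_basis_def
proof (intro conjI allI impI)
  show fU: "f ` I \<subseteq> U" using assms(2) by blast
  have G: "mult_subgroup (mspan H I f)" by (rule mspan_subgroup[OF fU])
  have bf: "b i = f i * (b i / f i)" if "i \<in> I" for i
    using mult_subgroupD(2)[OF sub_U assms(2)[OF that]] by simp
  have "b i \<in> mspan H I f" if "i \<in> I" for i
  proof (subst bf[OF that], rule mult_subgroupD(3)[OF G])
    show "f i \<in> mspan H I f" by (rule mspan_gen[OF that])
    show "b i / f i \<in> mspan H I f" using assms(3)[OF that] mspan_base by blast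
  qed
  then have "mspan H I b \<subseteq> mspan H I f" by (intro mspan_least[OF G mspan_base]) auto
  then show "U \<subseteq> mspan H I f" using fam_basisD(2)[OF assms(1)] by blast
  fix S and e :: "_ \<Rightarrow> nat" assume S: "finite S \<and> S \<subseteq> I \<and> (\<Prod>i\<in>S. f i ^ e i) \<in> H"
  have "(\<Prod>i\<in>S. b i ^ e i) = (\<Prod>i\<in>S. f i ^ e i) * (\<Prod>i\<in>S. (b i / f i) ^ e i)"
    unfolding prod.distrib[symmetric] using S bf
    by (intro prod.cong refl) (metis power_mult_distrib subsetD)
  moreover have "(\<Prod>i\<in>S. (b i / f i) ^ e i) \<in> H"
    using S assms(3) by (intro mult_subgroup_prod[OF sub_H] mult_subgroup_power[OF sub_H]) auto
  ultimately have "(\<Prod>i\<in>S. b i ^ e i) \<in> H" using S mult_subgroupD(3)[OF sub_H] by simp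
  then show "\<forall>i\<in>S. p dvd e i" using fam_basisD(3)[OF assms(1)] S by blast
qed

text \<open>Transport along the second isomorphism theorem: \<open>U2\<close> lies in
  \<open>U H2\<close>, and \<open>U\<close> meets \<open>H2\<close> in \<open>H\<close>.\<close>

lemma fam_basis_iso:
  assumes "fam_basis p U H I b"
    and "\<And>u. u \<in> U2 \<Longrightarrow> \<exists>v\<in>U. \<exists>h\<in>H2. u = v * h"
    and "U \<subseteq> U2" "mult_subgroup H2" "H \<subseteq> H2" "U \<inter> H2 \<subseteq> H"
  shows "fam_basis p U2 H2 I b"
  unfolding fam_basis_def
proof (intro conjI allI impI)
  show "b ` I \<subseteq> U2" using fam_basisD(1)[OF assms(1)] assms(3) by blast
  show "U2 \<subseteq> mspan H2 I b"
  proof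
    fix u assume "u \<in> U2"
    then obtain v h where v: "v \<in> U" "h \<in> H2" "u = v * h" using assms(2) by blast
    then obtain k T e where *: "k \<in> H" "finite T" "T \<subseteq> I" "v = k * (\<Prod>i\<in>T. b i ^ (e i::nat))"
      using fam_basisD(2)[OF assms(1)] by (blast elim: mspanE)
    have "k * h \<in> H2" using *(1) v(2) assms(4,5) mult_subgroupD(3) by blast
    then show "u \<in> mspan H2 I b" using * v(3) by (intro mspanI[where h = "k * h"]) (auto simp: mult_ac)
  qed
  fix S and e :: "_ \<Rightarrow> nat" assume S: "finite S \<and> S \<subseteq> I \<and> (\<Prod>i\<in>S. b i ^ e i) \<in> H2"
  have "(\<Prod>i\<in>S. b i ^ e i) \<in> U"
    using S fam_basisD(1)[OF assms(1)]
    by (intro mult_subgroup_prod[OF sub_U] mult_subgroup_power[OF sub_U]) auto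
  then have "(\<Prod>i\<in>S. b i ^ e i) \<in> H" using S assms(6) by blast
  then show "\<forall>i\<in>S. p dvd e i" using fam_basisD(3)[OF assms(1)] S by blast
qed

text \<open>The transport in the other direction: when the representatives lie in \<open>U\<close>,
  the factor from \<open>H2\<close> in the expansion of an element of \<open>U\<close> lies in
  \<open>U\<close> too, hence in \<open>H\<close>.\<close>

lemma fam_basis_restrict:
  assumes "fam_basis p U2 H2 I b" "\<And>i. i \<in> I \<Longrightarrow> b i \<in> U" "U \<subseteq> U2" "H \<subseteq> H2" "U \<inter> H2 \<subseteq> H"
  shows "fam_basis p U H I b"
  unfolding fam_basis_def
proof (intro conjI allI impI)
  show "b ` I \<subseteq> U" using assms(2) by blast
  show "U \<subseteq> mspan H I b"
  proof
    fix u assume u: "u \<in> U"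
    then obtain k T e where *: "k \<in> H2" "finite T" "T \<subseteq> I" "u = k * (\<Prod>i\<in>T. b i ^ (e i::nat))"
      using fam_basisD(2)[OF assms(1)] assms(3) by (blast elim: mspanE)
    have "(\<Prod>i\<in>T. b i ^ e i) \<in> U"
      using *(3) assms(2) by (intro mult_subgroup_prod[OF sub_U] mult_subgroup_power[OF sub_U]) auto
    then have "k \<in> U" using u *(4) mult_subgroup_cancel_left[OF sub_U] by (metis mult.commute)
    then show "u \<in> mspan H I b" using * assms(5) by (intro mspanI[where h = k]) auto
  qed
  fix S and e :: "_ \<Rightarrow> nat" assume S: "finite S \<and> S \<subseteq> I \<and> (\<Prod>i\<in>S. b i ^ e i) \<in> H"
  then show "\<forall>i\<in>S. p dvd e i" using fam_basisD(3)[OF assms(1)] assms(4) by blast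
qed

end

section \<open>Cyclic Kummer extensions of prime degree\<close>

text \<open>The extension enters through the generator \<open>alpha\<close>: that \<open>s\<close>
  has period \<open>p\<close> and fixes only \<open>F\<close> is derived, by showing that the powers
  of \<open>alpha\<close> span the whole field over \<open>F\<close>.\<close>

locale kummer_cyclic =
  fixes p :: nat and F :: "'k::field set" and xi a alpha :: 'k and s :: "'k \<Rightarrow> 'k"
  assumes prime_p: "prime p"
    and p_ne0: "of_nat p \<noteq> (0::'k)"
    and subF: "is_subfield F"
    and xi_F: "xi \<in> F" and xi_prim: "primitive_root p xi"
    and a_F: "a \<in> F" and a_ne0: "a \<noteq> 0" and a_nonpth: "\<forall>b\<in>F. b ^ p \<noteq> a"
    and alpha_pow: "alpha ^ p = a"
    and generates: "\<forall>L. is_subfield L \<and> F \<subseteq> L \<and> alpha \<in> L \<longrightarrow> L = UNIV"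
    and aut: "field_aut s" and s_fix: "\<And>x. x \<in> F \<Longrightarrow> s x = x" and s_alpha: "s alpha = xi * alpha"
begin

section \<open>Arithmetic of \<open>F\<close>, \<open>s\<close> and the roots of unity\<close>

lemma p_pos: "p > 0" and p_gt1: "p > 1"
  using prime_p prime_gt_0_nat prime_gt_1_nat by auto

lemma F_closed:
  "0 \<in> F" "1 \<in> F" "x \<in> F \<Longrightarrow> y \<in> F \<Longrightarrow> x + y \<in> F" "x \<in> F \<Longrightarrow> y \<in> F \<Longrightarrow> x * y \<in> F"
  "x \<in> F \<Longrightarrow> - x \<in> F" "x \<in> F \<Longrightarrow> inverse x \<in> F" "x \<in> F \<Longrightarrow> y \<in> F \<Longrightarrow> x / y \<in> F"
  using subF unfolding is_subfield_def divide_inverse by auto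

lemma F_power: "x \<in> F \<Longrightarrow> x ^ n \<in> F"
  by (induction n) (auto intro: F_closed)

lemma xi_pow: "xi ^ p = 1"
  using xi_prim by (simp add: primitive_root_def)

lemma xi_ne0: "xi \<noteq> 0"
  using xi_pow p_pos by (metis power_0_left zero_neq_one less_not_refl)

lemma alpha_ne0: "alpha \<noteq> 0"
  using alpha_pow a_ne0 p_pos by (metis power_0_left less_not_refl)

lemma s_add: "s (x + y) = s x + s y" and s_mult: "s (x * y) = s x * s y" and s_bij: "bij s"
  using aut by (auto simp: field_aut_def)

lemma s_0 [simp]: "s 0 = 0"
  using s_add[of 0 0] by (metis add_0 add_cancel_left_left)

lemma s_eq_0 [simp]: "s x = 0 \<longleftrightarrow> x = 0"
  using s_bij s_0 by (metis bij_pointE)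

lemma s_1 [simp]: "s 1 = 1"
  using s_mult[of 1 1] by simp

lemma s_power: "s (x ^ n) = s x ^ n"
  by (induction n) (auto simp: s_mult)

lemma s_inverse: "s (inverse x) = inverse (s x)"
proof (cases "x = 0")
  case False
  then have "s x * s (inverse x) = 1" by (simp flip: s_mult)
  then show ?thesis by (simp add: inverse_unique)
qed simp

lemma s_divide: "s (x / y) = s x / s y"
  by (simp add: divide_inverse s_mult s_inverse)

lemma s_sum: "s (sum f A) = (\<Sum>i\<in>A. s (f i))"
  by (induction A rule: infinite_finite_induct) (auto simp: s_add)

lemma s_prod: "s (prod f A) = (\<Prod>i\<in>A. s (f i))"
  by (induction A rule: infinite_finite_induct) (auto simp: s_mult)

lemma sk_0 [simp]: "(s ^^ k) 0 = 0"
  by (induction k) auto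

lemma sk_1 [simp]: "(s ^^ k) 1 = 1"
  by (induction k) auto

lemma sk_eq_0 [simp]: "(s ^^ k) x = 0 \<longleftrightarrow> x = 0"
  by (induction k) auto

lemma sk_mult: "(s ^^ k) (x * y) = (s ^^ k) x * (s ^^ k) y"
  by (induction k) (auto simp: s_mult)

lemma sk_sum: "(s ^^ k) (sum f A) = (\<Sum>i\<in>A. (s ^^ k) (f i))"
  by (induction k) (auto simp: s_sum)

lemma sk_power: "(s ^^ k) (x ^ n) = (s ^^ k) x ^ n"
  by (induction k) (auto simp: s_power)

lemma sk_fix: "x \<in> F \<Longrightarrow> (s ^^ k) x = x"
  by (induction k) (auto simp: s_fix)

lemma sk_alpha: "(s ^^ k) alpha = xi ^ k * alpha"
  by (induction k) (auto simp: s_mult s_power s_fix xi_F s_alpha)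

lemma sk_term: "c \<in> F \<Longrightarrow> (s ^^ k) (c * alpha ^ i) = c * alpha ^ i * (xi ^ i) ^ k"
  by (simp add: sk_mult sk_power sk_fix sk_alpha power_mult_distrib mult_ac flip: power_mult)

lemma xi_pow_eq_1_iff: "xi ^ n = 1 \<longleftrightarrow> p dvd n"
proof
  assume "p dvd n"
  then show "xi ^ n = 1" using xi_pow by (auto simp: power_mult elim!: dvdE)
next
  assume "xi ^ n = 1"
  moreover have "xi ^ n = xi ^ (p * (n div p) + n mod p)" by simp
  then have "xi ^ n = xi ^ (n mod p)" unfolding power_add power_mult xi_pow by simp
  ultimately have "xi ^ (n mod p) = 1" by simp
  moreover have "n mod p < p" using p_pos by simp
  ultimately have "n mod p = 0"
    using xi_prim unfolding primitive_root_def by (metis less_one not_le)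
  then show "p dvd n" by (simp add: dvd_eq_mod_eq_0)
qed

lemma sum_root_of_unity:
  fixes z :: 'k
  assumes "z ^ p = 1" "z \<noteq> 1"
  shows "(\<Sum>k<p. z ^ k) = 0"
  using power_diff_1_eq[of z p] assms by simp

lemma sum_xi_pow: "(\<Sum>k<p. (xi ^ i) ^ k) = (if p dvd i then of_nat p else 0)"
proof (cases "p dvd i")
  case True
  then show ?thesis using xi_pow_eq_1_iff[of i] by simp
next
  case False
  then have "(\<Sum>k<p. (xi ^ i) ^ k) = 0"
    using xi_pow xi_pow_eq_1_iff[of i] by (intro sum_root_of_unity) (simp_all flip: power_mult add: mult.commute[of i] power_mult)
  then show ?thesis using False by simp
qed

text \<open>If no \<open>z * xi ^ c\<close> were 1, all their geometric sums would vanish; but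
  orthogonality of the powers of \<open>xi\<close> makes these sums total \<open>p\<close>, which is
  nonzero in the field.\<close>

lemma root_of_unity_is_xi_pow:
  assumes "z ^ p = 1"
  shows "\<exists>c. z = xi ^ c"
proof -
  have "\<exists>c<p. z * xi ^ c = 1"
  proof (rule ccontr)
    assume neg: "\<not> (\<exists>c<p. z * xi ^ c = 1)"
    have zero: "(\<Sum>c<p. \<Sum>i<p. (z * xi ^ c) ^ i) = 0"
    proof (rule sum.neutral, rule ballI, rule sum_root_of_unity)
      fix c assume "c \<in> {..<p}"
      show "(z * xi ^ c) ^ p = 1"
        using assms xi_pow by (simp add: power_mult_distrib power_mult[symmetric] mult.commute[of c] power_mult)
      show "z * xi ^ c \<noteq> 1" using neg \<open>c \<in> {..<p}\<close> by blast
    qed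
    have "(\<Sum>c<p. \<Sum>i<p. (z * xi ^ c) ^ i) = (\<Sum>i<p. z ^ i * (\<Sum>c<p. (xi ^ i) ^ c))"
      by (subst sum.swap) (simp add: sum_distrib_left power_mult_distrib mult.commute flip: power_mult)
    also have "\<dots> = (\<Sum>i<p. if i = 0 then of_nat p else 0)"
    proof (intro sum.cong refl)
      fix i assume "i \<in> {..<p}"
      then have "p dvd i \<longleftrightarrow> i = 0" by (auto dest: dvd_imp_le)
      then show "z ^ i * (\<Sum>c<p. (xi ^ i) ^ c) = (if i = 0 then of_nat p else 0)"
        by (simp only: sum_xi_pow) simp
    qed
    also have "\<dots> = of_nat p" using p_pos by (simp add: sum.delta)
    finally show False using p_ne0 zero by simp
  qed
  then obtain c where c: "c < p" "z * xi ^ c = 1" by blast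
  have "xi ^ c * xi ^ (p - c) = 1" using c(1) xi_pow by (simp flip: power_add)
  then have "z = xi ^ (p - c)" using c(2) by (metis mult.assoc mult.commute mult_1)
  then show ?thesis by blast
qed

text \<open>The \<open>F\<close>-span of the powers of \<open>alpha\<close>; it turns out to be a field, hence all of \<open>K\<close>.\<close>

definition alpha_span :: "'k set" where
  "alpha_span = {\<Sum>i<p. c i * alpha ^ i | c. \<forall>i. c i \<in> F}"

lemma alpha_span_monomial:
  assumes "c \<in> F"
  shows "c * alpha ^ n \<in> alpha_span"
proof -
  define d where "d i = (if i = n mod p then c * a ^ (n div p) else 0)" for i
  have "(\<Sum>i<p. d i * alpha ^ i) = (\<Sum>i<p. if i = n mod p then c * a ^ (n div p) * alpha ^ (n mod p) else 0)"
    by (intro sum.cong) (auto simp: d_def)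
  also have "\<dots> = c * a ^ (n div p) * alpha ^ (n mod p)"
    using p_pos by (simp add: sum.delta)
  also have "\<dots> = c * alpha ^ (p * (n div p) + n mod p)"
    unfolding power_add power_mult alpha_pow by (simp only: mult_ac)
  finally have "c * alpha ^ n = (\<Sum>i<p. d i * alpha ^ i)" by simp
  moreover have "\<forall>i. d i \<in> F" using assms a_F by (auto simp: d_def intro: F_closed F_power)
  ultimately show ?thesis unfolding alpha_span_def by blast
qed

lemma alpha_span_add:
  assumes "x \<in> alpha_span" "y \<in> alpha_span"
  shows "x + y \<in> alpha_span"
proof -
  obtain c d where *: "\<forall>i. c i \<in> F" "x = (\<Sum>i<p. c i * alpha ^ i)" "\<forall>i. d i \<in> F" "y = (\<Sum>i<p. d i * alpha ^ i)"
    using assms unfolding alpha_span_def by blast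
  have "x + y = (\<Sum>i<p. (c i + d i) * alpha ^ i)" using * by (simp add: sum.distrib distrib_right)
  moreover have "\<forall>i. c i + d i \<in> F" using * F_closed by blast
  ultimately show ?thesis unfolding alpha_span_def by (intro CollectI exI[of _ "\<lambda>i. c i + d i"]) simp
qed

lemma alpha_span_F: "x \<in> F \<Longrightarrow> x \<in> alpha_span"
  using alpha_span_monomial[of x 0] by simp

lemma alpha_span_sum:
  assumes "\<And>i. i \<in> A \<Longrightarrow> f i \<in> alpha_span"
  shows "sum f A \<in> alpha_span"
  using assms
  by (induction A rule: infinite_finite_induct) (auto simp: alpha_span_F F_closed alpha_span_add)

lemma alpha_span_mult:
  assumes "x \<in> alpha_span" "y \<in> alpha_span"
  shows "x * y \<in> alpha_span"
proof -
  obtain c d where *: "\<forall>i. c i \<in> F" "x = (\<Sum>i<p. c i * alpha ^ i)" "\<forall>i. d i \<in> F" "y = (\<Sum>i<p. d i * alpha ^ i)"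
    using assms unfolding alpha_span_def by blast
  have "x * y = (\<Sum>i<p. \<Sum>j<p. (c i * d j) * alpha ^ (i + j))"
    unfolding * sum_product by (simp add: power_add mult_ac)
  also have "\<dots> \<in> alpha_span"
    using * by (intro alpha_span_sum alpha_span_monomial F_closed) auto
  finally show ?thesis .
qed

lemma alpha_span_prod:
  assumes "\<And>i. i \<in> A \<Longrightarrow> f i \<in> alpha_span"
  shows "prod f A \<in> alpha_span"
  using assms
  by (induction A rule: infinite_finite_induct) (auto simp: alpha_span_F F_closed alpha_span_mult)

lemma alpha_span_sk:
  assumes "x \<in> alpha_span"
  shows "(s ^^ k) x \<in> alpha_span"
proof -
  obtain c where c: "\<forall>i. c i \<in> F" "x = (\<Sum>i<p. c i * alpha ^ i)"
    using assms unfolding alpha_span_def by blast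
  have "(s ^^ k) x = (\<Sum>i<p. (c i * (xi ^ i) ^ k) * alpha ^ i)"
    unfolding c(2) sk_sum using c(1) by (simp add: sk_term mult_ac)
  also have "\<dots> \<in> alpha_span"
    using c(1) xi_F by (intro alpha_span_sum alpha_span_monomial F_closed F_power) auto
  finally show ?thesis .
qed

lemma alpha_span_period:
  assumes "x \<in> alpha_span"
  shows "(s ^^ p) x = x"
proof -
  obtain c where c: "\<forall>i. c i \<in> F" "x = (\<Sum>i<p. c i * alpha ^ i)"
    using assms unfolding alpha_span_def by blast
  have "(xi ^ i) ^ p = 1" for i by (metis mult.commute power_mult xi_pow power_one)
  then show ?thesis
    unfolding c(2) sk_sum using c(1) by (simp add: sk_term)
qed

text \<open>The trace of a fixed element \<open>x\<close> is \<open>p x\<close>, and it kills all but the constant coefficient.\<close>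

lemma alpha_span_fixed:
  assumes "x \<in> alpha_span" "s x = x"
  shows "x \<in> F"
proof -
  obtain c where c: "\<forall>i. c i \<in> F" "x = (\<Sum>i<p. c i * alpha ^ i)"
    using assms unfolding alpha_span_def by blast
  have "(s ^^ k) x = x" for k using assms(2) by (induction k) auto
  then have "of_nat p * x = (\<Sum>k<p. (s ^^ k) x)" by simp
  also have "\<dots> = (\<Sum>k<p. \<Sum>i<p. c i * alpha ^ i * (xi ^ i) ^ k)"
    unfolding c(2) sk_sum using c(1) by (simp add: sk_term)
  also have "\<dots> = (\<Sum>i<p. c i * alpha ^ i * (\<Sum>k<p. (xi ^ i) ^ k))"
    by (subst sum.swap) (simp add: sum_distrib_left)
  also have "\<dots> = (\<Sum>i<p. if i = 0 then of_nat p * c 0 else 0)"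
  proof (intro sum.cong refl)
    fix i assume "i \<in> {..<p}"
    then have "p dvd i \<longleftrightarrow> i = 0" by (auto dest: dvd_imp_le)
    then show "c i * alpha ^ i * (\<Sum>k<p. (xi ^ i) ^ k) = (if i = 0 then of_nat p * c 0 else 0)"
      by (simp only: sum_xi_pow) simp
  qed
  also have "\<dots> = of_nat p * c 0" using p_pos by (simp add: sum.delta)
  finally have "x = c 0" using p_ne0 by simp
  then show ?thesis using c(1) by simp
qed

section \<open>The norm, the fixed field and Hilbert 90\<close>

definition Nm :: "'k \<Rightarrow> 'k" where
  "Nm x = (\<Prod>k<p. (s ^^ k) x)"

text \<open>Applying \<open>s\<close> shifts the product by one and the period closes it up. The
  period is a hypothesis because at this point it is known only on
  \<open>alpha_span\<close>.\<close>

lemma Nm_fixed: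
  assumes "(s ^^ p) x = x"
  shows "s (Nm x) = Nm x"
proof -
  have "s (Nm x) * x = (\<Prod>k<p. (s ^^ Suc k) x) * (s ^^ 0) x" by (simp add: Nm_def s_prod)
  also have "\<dots> = (\<Prod>k<Suc p. (s ^^ k) x)" by (simp only: prod.lessThan_Suc_shift mult.commute)
  also have "\<dots> = Nm x * x" using assms by (simp add: Nm_def)
  finally show ?thesis by (cases "x = 0") (use p_pos in \<open>auto simp: Nm_def power_0_left\<close>)
qed

text \<open>The inverse is the product of the other conjugates divided by the norm. The norm is a
  fixed element of the span, hence lies in \<open>F\<close>, where inverses are available.\<close>

lemma alpha_span_subfield: "is_subfield alpha_span"
  unfolding is_subfield_def
proof (intro conjI ballI)
  show "0 \<in> alpha_span" "1 \<in> alpha_span" by (auto intro: alpha_span_F F_closed)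
  fix x assume x: "x \<in> alpha_span"
  show "x + y \<in> alpha_span" "x * y \<in> alpha_span" if "y \<in> alpha_span" for y
    using x that by (auto intro: alpha_span_add alpha_span_mult)
  show "- x \<in> alpha_span"
    using alpha_span_mult[OF alpha_span_F[OF F_closed(5)[OF F_closed(2)]] x] by simp
  show "inverse x \<in> alpha_span"
  proof (cases "x = 0")
    case True
    then show ?thesis by (auto intro: alpha_span_F F_closed)
  next
    case False
    have NF: "Nm x \<in> F"
      using x by (intro alpha_span_fixed Nm_fixed alpha_span_period)
        (auto simp: Nm_def intro: alpha_span_prod alpha_span_sk)
    have "Nm x = x * (\<Prod>k\<in>{..<p} - {0}. (s ^^ k) x)"
      unfolding Nm_def using p_pos by (subst prod.remove[of _ 0]) auto
    moreover have "Nm x \<noteq> 0" using False by (simp add: Nm_def)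
    ultimately have "inverse x = (\<Prod>k\<in>{..<p} - {0}. (s ^^ k) x) * inverse (Nm x)"
      using False by (simp add: field_simps)
    also have "\<dots> \<in> alpha_span"
      by (intro alpha_span_mult alpha_span_prod alpha_span_sk x alpha_span_F[OF F_closed(6)[OF NF]])
    finally show ?thesis .
  qed
qed

lemma alpha_span_UNIV: "alpha_span = UNIV"
  using generates alpha_span_subfield alpha_span_F alpha_span_monomial[of 1 1] F_closed(2) by auto

lemma s_period: "(s ^^ p) x = x"
  using alpha_span_period alpha_span_UNIV by blast

lemma fixed_in_F: "s x = x \<Longrightarrow> x \<in> F"
  using alpha_span_fixed alpha_span_UNIV by blast

lemma Nm_F: "Nm x \<in> F"
  by (intro fixed_in_F Nm_fixed s_period)

lemma Nm_mult: "Nm (x * y) = Nm x * Nm y"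
  by (simp add: Nm_def sk_mult prod.distrib)

lemma Nm_ne0 [simp]: "Nm x = 0 \<longleftrightarrow> x = 0"
  using p_pos by (auto simp: Nm_def)

lemma Nm_1 [simp]: "Nm 1 = 1"
  by (simp add: Nm_def)

lemma Nm_inverse: "Nm (inverse x) = inverse (Nm x)"
proof (cases "x = 0")
  case False
  then have "Nm x * Nm (inverse x) = 1" by (simp flip: Nm_mult)
  then show ?thesis by (simp add: inverse_unique)
qed (simp add: Nm_def power_0_left)

lemma Nm_power: "Nm (x ^ n) = Nm x ^ n"
  by (induction n) (auto simp: Nm_mult)

lemma Nm_prod: "Nm (prod f A) = (\<Prod>i\<in>A. Nm (f i))"
  by (induction A rule: infinite_finite_induct) (auto simp: Nm_mult)

lemma Nm_of_F: "x \<in> F \<Longrightarrow> Nm x = x ^ p"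
  by (simp add: Nm_def sk_fix)

lemma Nm_s: "Nm (s x) = Nm x"
proof -
  have "Nm (s x) = s (Nm x)" by (simp add: Nm_def s_prod funpow_swap1)
  then show ?thesis using Nm_fixed[OF s_period] by simp
qed

lemma Nm_sk: "Nm ((s ^^ k) x) = Nm x"
  by (induction k) (auto simp: Nm_s)

text \<open>A Lagrange resolvent of some power of \<open>alpha\<close> does not vanish, since the resolvents of
  \<open>alpha ^ i\<close>, divided by \<open>alpha ^ i\<close>, add up to \<open>p\<close>.\<close>

lemma hilbert90:
  assumes "Nm y = 1"
  obtains z where "z \<noteq> 0" "y = s z / z"
proof -
  have y0: "y \<noteq> 0" using assms by (metis Nm_ne0 zero_neq_one)
  \<comment> \<open>The partial norms of \<open>y\<close> satisfy
    \<open>y * s (Y k) = Y (Suc k)\<close> and close up with \<open>Y p = 1\<close>, so every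
    resolvent \<open>R t\<close> built from them satisfies \<open>y * s (R t) = R t\<close>.\<close>
  define Y where "Y k = (\<Prod>j<k. (s ^^ j) y)" for k
  have Y_Suc: "y * s (Y k) = Y (Suc k)" for k
    unfolding Y_def prod.lessThan_Suc_shift by (simp add: s_prod)
  have Yp: "Y p = 1" using assms by (simp add: Y_def Nm_def)
  define R where "R t = (\<Sum>k<p. Y k * (s ^^ k) t)" for t
  have R: "y * s (R t) = R t" for t
  proof -
    have "y * s (R t) = (\<Sum>k<p. Y (Suc k) * (s ^^ Suc k) t)"
      unfolding R_def s_sum sum_distrib_left by (simp add: s_mult flip: Y_Suc mult.assoc)
    then have "y * s (R t) + Y 0 * (s ^^ 0) t = (\<Sum>k<Suc p. Y k * (s ^^ k) t)"
      by (simp only: sum.lessThan_Suc_shift add.commute)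
    also have "\<dots> = R t + Y p * (s ^^ p) t" by (simp add: R_def)
    finally show ?thesis by (simp add: Yp s_period) (simp add: Y_def)
  qed
  have "\<exists>i<p. R (alpha ^ i) \<noteq> 0"
  proof (rule ccontr)
    assume neg: "\<not> (\<exists>i<p. R (alpha ^ i) \<noteq> 0)"
    have R_alpha: "R (alpha ^ i) = alpha ^ i * (\<Sum>k<p. Y k * (xi ^ k) ^ i)" for i
    proof -
      have "(s ^^ k) (alpha ^ i) = alpha ^ i * (xi ^ k) ^ i" for k
        by (simp add: sk_power sk_alpha power_mult_distrib mult.commute)
      then show ?thesis unfolding R_def sum_distrib_left by (simp add: mult_ac)
    qed
    have "(\<Sum>k<p. Y k * (xi ^ k) ^ i) = 0" if "i < p" for i
      using R_alpha[of i] neg that alpha_ne0 by simp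
    then have "(\<Sum>i<p. \<Sum>k<p. Y k * (xi ^ k) ^ i) = 0" by simp
    also have "(\<Sum>i<p. \<Sum>k<p. Y k * (xi ^ k) ^ i) = (\<Sum>k<p. Y k * (\<Sum>i<p. (xi ^ k) ^ i))"
      by (subst sum.swap) (simp add: sum_distrib_left)
    also have "\<dots> = (\<Sum>k<p. if k = 0 then of_nat p else 0)"
    proof (intro sum.cong refl)
      fix k assume "k \<in> {..<p}"
      then have "p dvd k \<longleftrightarrow> k = 0" by (auto dest: dvd_imp_le)
      then show "Y k * (\<Sum>i<p. (xi ^ k) ^ i) = (if k = 0 then of_nat p else 0)"
        by (simp only: sum_xi_pow) (simp add: Y_def)
    qed
    also have "\<dots> = of_nat p" using p_pos by (simp add: sum.delta)
    finally show False using p_ne0 by simp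
  qed
  then obtain t where t: "R t \<noteq> 0" by blast
  let ?z = "inverse (R t)"
  have "y = R t / s (R t)" using R[of t] t by (simp add: eq_divide_eq)
  also have "\<dots> = s ?z / ?z" by (simp add: s_inverse divide_inverse mult.commute)
  finally have "y = s ?z / ?z" .
  then show ?thesis using that[of ?z] t by simp
qed

section \<open>The module \<open>J\<close> of classes modulo p-th powers\<close>

abbreviation P :: "'k set" where "P \<equiv> pth p"

lemma P_I: "y \<noteq> 0 \<Longrightarrow> y ^ p \<in> P"
  by (auto simp: pth_def)

lemma P_E:
  assumes "x \<in> P"
  obtains y where "y \<noteq> 0" "x = y ^ p"
  using assms by (auto simp: pth_def)

lemma mult_subgroup_units: "mult_subgroup (- {0::'k})"
  by (auto simp: mult_subgroup_def)

lemma mult_subgroup_P: "mult_subgroup P"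
  unfolding mult_subgroup_def
proof (intro conjI ballI)
  show "1 \<in> P" using P_I[of 1] by simp
  show "0 \<notin> P" by (auto elim: P_E)
  show "x * y \<in> P" if "x \<in> P" "y \<in> P" for x y
    using that by (elim P_E) (simp add: P_I flip: power_mult_distrib)
  show "inverse x \<in> P" if "x \<in> P" for x
    using that by (elim P_E) (simp add: P_I flip: power_inverse)
qed

sublocale J: Fp_quotient p "- {0}" P
  using prime_p mult_subgroup_units mult_subgroup_P P_I mult_subgroupD(2)[OF mult_subgroup_P]
  by unfold_locales auto

lemma P_mult: "x \<in> P \<Longrightarrow> y \<in> P \<Longrightarrow> x * y \<in> P"
  by (rule mult_subgroupD(3)[OF mult_subgroup_P])

lemma P_ne0: "x \<in> P \<Longrightarrow> x \<noteq> 0"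
  by (rule mult_subgroupD(2)[OF mult_subgroup_P])

lemma P_1: "1 \<in> P"
  by (rule mult_subgroupD(1)[OF mult_subgroup_P])

lemma s_P: "x \<in> P \<Longrightarrow> s x \<in> P"
  by (elim P_E) (simp add: s_power P_I)

section \<open>The operator \<open>\<sigma> - 1\<close>, and the norm as its power\<close>

definition tau :: "'k \<Rightarrow> 'k" where
  "tau x = s x / x"

lemma tau_0 [simp]: "tau 0 = 0" and tau_1 [simp]: "tau 1 = 1"
  by (simp_all add: tau_def)

lemma tau_eq_0 [simp]: "tau x = 0 \<longleftrightarrow> x = 0"
  by (simp add: tau_def)

lemma tauk_eq_0 [simp]: "(tau ^^ k) x = 0 \<longleftrightarrow> x = 0"
  by (induction k) auto

lemma s_eq_tau: "s x = tau x * x"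
  by (cases "x = 0") (auto simp: tau_def)

lemma tau_mult: "tau (x * y) = tau x * tau y"
  by (simp add: tau_def s_mult)

lemma tau_power: "tau (x ^ n) = tau x ^ n"
  by (simp add: tau_def s_power power_divide)

lemma tau_inverse: "tau (inverse x) = inverse (tau x)"
  by (simp add: tau_def s_inverse divide_inverse mult.commute)

lemma tau_divide: "tau (x / y) = tau x / tau y"
  by (simp add: divide_inverse tau_mult tau_inverse)

lemma tauk_mult: "(tau ^^ k) (x * y) = (tau ^^ k) x * (tau ^^ k) y"
  by (induction k) (auto simp: tau_mult)

lemma tauk_1 [simp]: "(tau ^^ k) 1 = 1"
  by (induction k) auto

lemma tauk_inverse: "(tau ^^ k) (inverse x) = inverse ((tau ^^ k) x)"
  by (induction k) (auto simp: tau_inverse)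

lemma tauk_power: "(tau ^^ k) (x ^ n) = (tau ^^ k) x ^ n"
  by (induction k) (auto simp: tau_power)

lemma tauk_prod: "(tau ^^ k) (prod f A) = (\<Prod>i\<in>A. (tau ^^ k) (f i))"
  by (induction A rule: infinite_finite_induct) (auto simp: tauk_mult)

lemma tau_prod: "tau (prod f A) = (\<Prod>i\<in>A. tau (f i))"
  using tauk_prod[of 1] by simp

lemma tau_P: "x \<in> P \<Longrightarrow> tau x \<in> P"
  by (elim P_E) (simp add: tau_power P_I)

lemma tauk_P: "x \<in> P \<Longrightarrow> (tau ^^ k) x \<in> P"
  by (induction k) (auto simp: tau_P)

lemma tau_F: "x \<in> F \<Longrightarrow> x \<noteq> 0 \<Longrightarrow> tau x = 1"
  by (simp add: tau_def s_fix)

lemma tau_eq_1: "tau x = 1 \<Longrightarrow> x \<in> F"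
  by (rule fixed_in_F) (simp add: s_eq_tau)

lemma tau_alpha: "tau alpha = xi"
  using alpha_ne0 by (simp add: tau_def s_alpha)

lemma Nm_tau: "x \<noteq> 0 \<Longrightarrow> Nm (tau x) = 1"
  by (simp add: tau_def divide_inverse Nm_mult Nm_inverse Nm_s)

text \<open>The binomial expansion of \<open>(1 + \<tau>) ^ n\<close>, written multiplicatively; the
  induction step is Pascal's rule.\<close>

lemma sk_tau_binomial: "(s ^^ n) x = (\<Prod>k\<le>n. (tau ^^ k) x ^ (n choose k))"
proof (induction n)
  case (Suc n)
  have "(s ^^ Suc n) x = (\<Prod>k\<le>n. ((tau ^^ Suc k) x * (tau ^^ k) x) ^ (n choose k))"
    using Suc by (simp add: s_prod s_power flip: s_eq_tau)
  also have "\<dots> = (\<Prod>k\<le>n. (tau ^^ Suc k) x ^ (n choose k)) * (\<Prod>k\<le>Suc n. (tau ^^ k) x ^ (n choose k))"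
    by (simp add: power_mult_distrib prod.distrib binomial_eq_0)
  also have "\<dots> = (\<Prod>k\<le>Suc n. (tau ^^ k) x ^ (Suc n choose k))"
    unfolding prod.atMost_Suc_shift by (simp add: power_add prod.distrib mult_ac)
  finally show ?case .
qed simp

text \<open>The expansion of \<open>((1 + \<tau>) ^ n - 1) / \<tau>\<close>, obtained from the
  previous one by summation with Pascal's rule.\<close>

lemma partial_norm_tau_binomial: "(\<Prod>k<n. (s ^^ k) x) = (\<Prod>k<n. (tau ^^ k) x ^ (n choose Suc k))"
proof (induction n)
  case (Suc n)
  have "(\<Prod>k<Suc n. (s ^^ k) x)
      = (\<Prod>k<Suc n. (tau ^^ k) x ^ (n choose Suc k)) * (\<Prod>k<Suc n. (tau ^^ k) x ^ (n choose k))"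
    using Suc sk_tau_binomial[of n x] by (simp add: lessThan_Suc_atMost[symmetric] binomial_eq_0)
  also have "\<dots> = (\<Prod>k<Suc n. (tau ^^ k) x ^ (Suc n choose Suc k))"
    by (simp add: power_add prod.distrib[symmetric] mult.commute)
  finally show ?case .
qed simp

text \<open>In characteristic \<open>p\<close>, the norm element \<open>((1 + t) ^ p - 1) / t\<close> is \<open>t ^ (p - 1)\<close>.\<close>

lemma Nm_tau_power:
  assumes "x \<noteq> 0"
  obtains y where "y \<in> P" "Nm x = (tau ^^ (p - 1)) x * y"
proof -
  have p: "p = Suc (p - 1)" using p_pos by simp
  have "Nm x = (\<Prod>k<Suc (p - 1). (tau ^^ k) x ^ (p choose Suc k))"
    unfolding Nm_def partial_norm_tau_binomial using p by simp
  also have "\<dots> = (tau ^^ (p - 1)) x * (\<Prod>k<p - 1. (tau ^^ k) x ^ (p choose Suc k))"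
    using p by (subst prod.lessThan_Suc) (simp add: mult.commute)
  finally have eq: "Nm x = (tau ^^ (p - 1)) x * (\<Prod>k<p - 1. (tau ^^ k) x ^ (p choose Suc k))" .
  have "(\<Prod>k<p - 1. (tau ^^ k) x ^ (p choose Suc k)) \<in> P"
  proof (rule mult_subgroup_prod[OF mult_subgroup_P])
    fix k assume "k \<in> {..<p - 1}"
    then have "p dvd (p choose Suc k)" by (intro dvd_choose_prime prime_p) auto
    then show "(tau ^^ k) x ^ (p choose Suc k) \<in> P" using assms by (intro J.pow_dvd_mem) auto
  qed
  then show ?thesis using eq that by blast
qed

text \<open>Modulo p-th powers, \<open>tau ^^ p\<close> is \<open>tau\<close> applied to the norm,
  and norms lie in \<open>F\<close>, where \<open>tau\<close> is trivial.\<close>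

lemma tau_p_in_P:
  assumes "x \<noteq> 0"
  shows "(tau ^^ p) x \<in> P"
proof -
  obtain y where y: "y \<in> P" "Nm x = (tau ^^ (p - 1)) x * y" using Nm_tau_power[OF assms] .
  have "1 = tau (Nm x)" using assms Nm_F by (simp add: tau_F)
  also have "\<dots> = (tau ^^ Suc (p - 1)) x * tau y" using y by (simp add: tau_mult)
  also have "Suc (p - 1) = p" using p_pos by simp
  finally have "tau y * (tau ^^ p) x = 1" by (simp add: mult.commute)
  then show ?thesis
    using mult_subgroup_cancel_left[OF mult_subgroup_P tau_P[OF y(1)]] P_1 by metis
qed

section \<open>The filtration of the fixed classes by powers of \<open>tau\<close>\<close>

definition V :: "nat \<Rightarrow> 'k set" where
  "V k = {x. x \<noteq> 0 \<and> tau x \<in> P \<and> (\<exists>w y. w \<noteq> 0 \<and> y \<in> P \<and> x = (tau ^^ k) w * y)}"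

lemma V_I: "w \<noteq> 0 \<Longrightarrow> y \<in> P \<Longrightarrow> x = (tau ^^ k) w * y \<Longrightarrow> tau x \<in> P \<Longrightarrow> x \<in> V k"
  unfolding V_def using P_ne0 by auto

lemma V_E:
  assumes "x \<in> V k"
  obtains w y where "w \<noteq> 0" "y \<in> P" "x = (tau ^^ k) w * y" "tau ((tau ^^ k) w) \<in> P"
proof -
  obtain w y where *: "w \<noteq> 0" "y \<in> P" "x = (tau ^^ k) w * y" "tau x \<in> P"
    using assms unfolding V_def by blast
  have "tau y * tau ((tau ^^ k) w) \<in> P" using * by (simp add: tau_mult mult.commute)
  then have "tau ((tau ^^ k) w) \<in> P"
    by (rule mult_subgroup_cancel_left[OF mult_subgroup_P tau_P[OF *(2)]])
  then show ?thesis using * that by blast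
qed

lemma V_0: "V 0 = {x. x \<noteq> 0 \<and> tau x \<in> P}"
  unfolding V_def using P_1 P_ne0 by (auto intro: exI[of _ 1])

lemma V_tau: "x \<in> V k \<Longrightarrow> tau x \<in> P" and V_ne0: "x \<in> V k \<Longrightarrow> x \<noteq> 0"
  by (auto simp: V_def)

lemma mult_subgroup_V: "mult_subgroup (V k)"
  unfolding mult_subgroup_def
proof (intro conjI ballI)
  show "1 \<in> V k" using P_1 by (intro V_I[of 1 1]) auto
  show "0 \<notin> V k" by (auto simp: V_def)
next
  fix x y assume "x \<in> V k" "y \<in> V k"
  then obtain w u w' u' where *: "w \<noteq> 0" "u \<in> P" "x = (tau ^^ k) w * u" "tau x \<in> P"
    "w' \<noteq> 0" "u' \<in> P" "y = (tau ^^ k) w' * u'" "tau y \<in> P" unfolding V_def by blast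
  then show "x * y \<in> V k"
    by (intro V_I[of "w * w'" "u * u'"]) (auto simp: P_mult tau_mult tauk_mult)
next
  fix x assume "x \<in> V k"
  then obtain w u where *: "w \<noteq> 0" "u \<in> P" "x = (tau ^^ k) w * u" "tau x \<in> P"
    unfolding V_def by blast
  have "tau (inverse x) \<in> P" using *(4) by (simp add: tau_inverse mult_subgroupD(4)[OF mult_subgroup_P])
  then show "inverse x \<in> V k" using *
    by (intro V_I[of "inverse w" "inverse u"])
      (auto simp: mult_subgroupD(4)[OF mult_subgroup_P] tauk_inverse)
qed

lemma P_subset_V: "P \<subseteq> V k"
proof
  fix x assume "x \<in> P"
  then show "x \<in> V k" by (intro V_I[of 1 x]) (auto simp: tau_P)
qed

lemma V_antimono:
  assumes "k \<le> l"
  shows "V l \<subseteq> V k"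
proof
  fix x assume x: "x \<in> V l"
  then obtain w y where *: "w \<noteq> 0" "y \<in> P" "x = (tau ^^ l) w * y" by (elim V_E)
  have "(tau ^^ l) w = (tau ^^ k) ((tau ^^ (l - k)) w)"
    using assms by (metis comp_apply funpow_add le_add_diff_inverse)
  then show "x \<in> V k" using * V_tau[OF x] by (intro V_I[of "(tau ^^ (l - k)) w" y]) auto
qed

lemma Fp_quotient_V: "k \<le> l \<Longrightarrow> Fp_quotient p (V k) (V l)"
  using prime_p mult_subgroup_V V_antimono P_subset_V P_I V_ne0
  by unfold_locales blast+

lemma V_p: "V p = P"
proof
  show "V p \<subseteq> P"
    by (auto elim!: V_E intro!: P_mult tau_p_in_P)
qed (rule P_subset_V)

lemma normJ_pre_eq: "normJ_pre p s = {Nm x * y | x y. x \<noteq> 0 \<and> y \<in> P}"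
  unfolding normJ_pre_def Nm_def pth_def by blast

lemma normK_eq: "normK p s = {Nm x | x. x \<noteq> 0}"
  unfolding normK_def Nm_def by blast

lemma V_norm: "V (p - 1) = normJ_pre p s"
proof (intro equalityI subsetI)
  fix x assume "x \<in> V (p - 1)"
  then obtain w y where *: "w \<noteq> 0" "y \<in> P" "x = (tau ^^ (p - 1)) w * y" by (elim V_E)
  obtain u where u: "u \<in> P" "Nm w = (tau ^^ (p - 1)) w * u" using Nm_tau_power[OF *(1)] .
  have "x = Nm w * (y / u)" using * u P_ne0 by simp
  then show "x \<in> normJ_pre p s"
    unfolding normJ_pre_eq using * mult_subgroupD(5)[OF mult_subgroup_P *(2) u(1)] by blast
next
  fix x assume "x \<in> normJ_pre p s"
  then obtain w y where *: "w \<noteq> 0" "y \<in> P" "x = Nm w * y" unfolding normJ_pre_eq by blast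
  obtain u where u: "u \<in> P" "Nm w = (tau ^^ (p - 1)) w * u" using Nm_tau_power[OF *(1)] .
  have "tau x \<in> P" using * by (simp add: tau_mult tau_F Nm_F tau_P)
  then show "x \<in> V (p - 1)" using * u by (intro V_I[of w "u * y"]) (auto simp: P_mult)
qed

section \<open>The filtration of the fixed classes\<close>

lemma mult_subgroup_F: "mult_subgroup (F - {0})"
  using F_closed by (auto simp: mult_subgroup_def)

lemma mult_subgroup_normK: "mult_subgroup (normK p s)"
  unfolding mult_subgroup_def
proof (intro conjI ballI)
  show "1 \<in> normK p s" unfolding normK_eq by (auto intro!: exI[of _ 1])
  show "0 \<notin> normK p s" by (auto simp: normK_eq)
  show "x * y \<in> normK p s" if "x \<in> normK p s" "y \<in> normK p s" for x y
    using that unfolding normK_eq by clarsimp (metis Nm_mult mult_eq_0_iff)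
  show "inverse x \<in> normK p s" if "x \<in> normK p s" for x
    using that unfolding normK_eq by clarsimp (metis Nm_inverse inverse_nonzero_iff_nonzero)
qed

lemma normK_I: "x \<noteq> 0 \<Longrightarrow> Nm x \<in> normK p s"
  by (auto simp: normK_eq)

lemma normK_F: "normK p s \<subseteq> F - {0}"
  by (auto simp: normK_eq Nm_F)

sublocale FN: Fp_quotient p "F - {0}" "normK p s"
proof
  show "u ^ p \<in> normK p s" if "u \<in> F - {0}" for u
    using that normK_I[of u] by (simp add: Nm_of_F)
qed (use prime_p mult_subgroup_F mult_subgroup_normK normK_F in auto)

lemma F_pth_subgroup: "mult_subgroup {g ^ p | g. g \<in> F - {0}}"
  unfolding mult_subgroup_def
proof (intro conjI ballI)
  show "1 \<in> {g ^ p | g. g \<in> F - {0}}" using F_closed(2) by (auto intro!: exI[of _ 1])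
  show "0 \<notin> {g ^ p | g. g \<in> F - {0}}" by auto
  show "x * y \<in> {g ^ p | g. g \<in> F - {0}}" if "x \<in> {g ^ p | g. g \<in> F - {0}}" "y \<in> {g ^ p | g. g \<in> F - {0}}" for x y
    using that by clarsimp (metis F_closed(4) power_mult_distrib mult_eq_0_iff)
  show "inverse x \<in> {g ^ p | g. g \<in> F - {0}}" if "x \<in> {g ^ p | g. g \<in> F - {0}}" for x
    using that by clarsimp (metis F_closed(6) power_inverse inverse_nonzero_iff_nonzero)
qed

text \<open>As \<open>a\<close> is not a p-th power in \<open>F\<close>, its class modulo p-th
  powers of \<open>F\<close> has order exactly \<open>p\<close>, by \<open>root_mem\<close>.\<close>

lemma a_power_pth:
  assumes "a ^ n = g ^ p" "g \<in> F"
  shows "p dvd n"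
proof (rule ccontr)
  assume n: "\<not> p dvd n"
  interpret Q: Fp_quotient p "F - {0}" "{g ^ p | g. g \<in> F - {0}}"
    by unfold_locales (use prime_p mult_subgroup_F F_pth_subgroup F_power in auto)
  have "g \<noteq> 0" using assms(1) a_ne0 p_pos by (metis power_eq_0_iff)
  then have "a \<in> {g ^ p | g. g \<in> F - {0}}"
    using assms a_F a_ne0 n by (intro Q.root_mem[OF F_pth_subgroup, of a n]) auto
  then show False using a_nonpth by auto
qed

section \<open>The norm of \<open>alpha\<close>, and p-th powers that lie in
  \<open>F\<close>\<close>

lemma Nm_alpha: "Nm alpha = xi ^ (\<Sum>k<p. k) * a"
  by (simp add: Nm_def sk_alpha prod.distrib alpha_pow power_sum)

lemma Nm_alpha_odd:
  assumes "odd p"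
  shows "Nm alpha = a"
proof -
  have "(\<Sum>k<p. k) = p * ((p - 1) div 2)"
    using Sum_Ico_nat[of 0 p] assms by (auto simp: atLeast0LessThan elim!: oddE)
  then show ?thesis using xi_pow_eq_1_iff by (simp add: Nm_alpha)
qed

lemma xi_pow_p_minus: "xi ^ n * xi ^ (n * (p - 1)) = 1"
proof -
  have "n + n * (p - 1) = p * n" using p_pos by (cases p) auto
  then show ?thesis by (metis power_add power_mult xi_pow power_one)
qed

text \<open>The power of \<open>xi\<close> makes this uniform in \<open>p\<close>: for
  \<open>p = 2\<close> the norm of \<open>alpha\<close> is \<open>- a\<close>.\<close>

lemma a_eq_norm: "\<exists>c. a = Nm alpha * xi ^ c"
proof -
  have "Nm alpha * xi ^ ((\<Sum>k<p. k) * (p - 1)) = a"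
    unfolding Nm_alpha using xi_pow_p_minus[of "\<Sum>k<p. k"] by (simp add: mult_ac)
  then show ?thesis by metis
qed

text \<open>Kummer theory: if \<open>y ^ p\<close> lies in \<open>F\<close>, then
  \<open>tau y\<close> is a root of unity \<open>xi ^ c = tau (alpha ^ c)\<close>, so
  \<open>y / alpha ^ c\<close> is fixed and lies in \<open>F\<close>.\<close>

lemma F_inter_P:
  assumes "x \<in> F" "x \<in> P"
  obtains c g where "g \<in> F" "g \<noteq> 0" "x = a ^ c * g ^ p"
proof -
  obtain y where y: "y \<noteq> 0" "x = y ^ p" using assms(2) by (elim P_E)
  have "tau y ^ p = 1" using tau_F[OF assms(1)] y by (simp add: tau_power)
  then obtain c where c: "tau y = xi ^ c" using root_of_unity_is_xi_pow by blast
  let ?g = "y / alpha ^ c"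
  have "tau ?g = 1" using c xi_ne0 by (simp add: tau_divide tau_power tau_alpha)
  then have "?g \<in> F" by (rule tau_eq_1)
  moreover have "y ^ p = a ^ c * ?g ^ p"
    using alpha_ne0 alpha_pow by (simp add: power_divide mult.commute flip: power_mult)
      (metis a_ne0 mult.commute nonzero_mult_div_cancel_left power_mult power_not_zero)
  ultimately show ?thesis using that[of ?g c] y alpha_ne0 by simp
qed

text \<open>The element \<open>p - N\<close> is divisible by \<open>\<sigma> - 1\<close> in the integral group ring.\<close>

lemma pow_div_norm_is_tau:
  assumes "z \<noteq> 0"
  obtains v where "v \<noteq> 0" "s v * Nm z = v * z ^ p" "Nm v = Nm z ^ (\<Sum>j<p. j)"
proof -
  \<comment> \<open>Additively, \<open>?v p\<close> is \<open>z\<close> under the sum of the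
    \<open>j \<sigma>^j\<close> over \<open>j < p\<close>, and \<open>\<sigma> - 1\<close> times
    this sum is \<open>p - N\<close>.\<close>
  let ?v = "\<lambda>n. \<Prod>j<n. ((s ^^ j) z) ^ j"
  have "s (?v p) * Nm (s z) = (\<Prod>j<p. ((s ^^ Suc j) z) ^ Suc j)"
    by (simp add: Nm_def s_prod s_power prod.distrib[symmetric] funpow_swap1 mult.commute)
  also have "\<dots> = ?v (Suc p)"
    unfolding prod.lessThan_Suc_shift by simp
  also have "\<dots> = ?v p * z ^ p" by (simp add: s_period)
  finally have "s (?v p) * Nm z = ?v p * z ^ p" by (simp add: Nm_s)
  moreover have "Nm (?v p) = Nm z ^ (\<Sum>j<p. j)"
    by (simp add: Nm_prod Nm_power Nm_sk power_sum)
  moreover have "?v p \<noteq> 0" using assms by simp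
  ultimately show ?thesis using that by blast
qed

text \<open>The equation says \<open>tau w = zeta * tau v\<close> for the \<open>v\<close> with
  \<open>tau v = z ^ p / Nm z\<close>. Since \<open>zeta = xi ^ c = tau (alpha ^ c)\<close>,
  \<open>w\<close> is \<open>alpha ^ c * v\<close> up to a factor from \<open>F\<close>. Taking
  norms makes \<open>a ^ c\<close> a p-th power in \<open>F\<close>, which forces
  \<open>p dvd c\<close>.\<close>

lemma twist_trivial:
  assumes "odd p" "w \<noteq> 0" "z \<noteq> 0" "Nm w = 1" "zeta ^ p = 1"
    and eq: "s w * Nm z = zeta * w * z ^ p"
  shows "zeta = 1"
proof -
  obtain c where c: "zeta = xi ^ c" using root_of_unity_is_xi_pow assms(5) by blast
  obtain v where v: "v \<noteq> 0" "s v * Nm z = v * z ^ p" "Nm v = Nm z ^ (\<Sum>j<p. j)"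
    using pow_div_norm_is_tau[OF assms(3)] .
  have tw: "tau w = xi ^ c * z ^ p / Nm z" and tv: "tau v = z ^ p / Nm z"
    using eq v(1,2) assms(2,3) c unfolding tau_def by (simp_all add: divide_simps mult_ac)
  let ?u = "w / (alpha ^ c * v)"
  have "tau ?u = 1"
    using tw tv v(1) xi_ne0 assms(3) by (simp add: tau_divide tau_mult tau_power tau_alpha)
  then have uF: "?u \<in> F" by (rule tau_eq_1)
  \<comment> \<open>Oddness of \<open>p\<close> makes this exponent of \<open>Nm z\<close> in
    \<open>Nm v\<close> a multiple of \<open>p\<close>, so that \<open>Nm v\<close> is a p-th power
    in \<open>F\<close>.\<close>
  have sum: "(\<Sum>k<p. k) = ((p - 1) div 2) * p"
    using Sum_Ico_nat[of 0 p] assms(1) by (auto simp: atLeast0LessThan elim!: oddE)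
  let ?g = "?u * Nm z ^ ((p - 1) div 2)"
  have "w = ?u * alpha ^ c * v" using alpha_ne0 v(1) by simp
  then have "1 = Nm (?u * alpha ^ c * v)" using assms(4) by simp
  also have "\<dots> = ?u ^ p * a ^ c * Nm z ^ (((p - 1) div 2) * p)"
    by (simp only: Nm_mult Nm_power Nm_of_F[OF uF] Nm_alpha_odd[OF assms(1)] v(3) sum)
  also have "\<dots> = a ^ c * ?g ^ p" unfolding power_mult_distrib power_mult by (simp only: mult_ac)
  finally have "a ^ c * ?g ^ p = 1" by simp
  then have "a ^ c = inverse ?g ^ p" by (metis inverse_unique mult.commute power_inverse)
  moreover have "inverse ?g \<in> F" by (intro F_closed F_power uF Nm_F)
  ultimately have "p dvd c" by (rule a_power_pth)
  then show ?thesis using c xi_pow_eq_1_iff by simp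
qed

text \<open>Writing \<open>tau u = y ^ p\<close>, the root of unity \<open>Nm y\<close> is trivial
  by \<open>twist_trivial\<close>. Hilbert 90 gives \<open>y = tau z\<close>, so
  \<open>u / z ^ p\<close> is some \<open>f\<close> in \<open>F\<close>, and \<open>Nm u = 1\<close>
  makes \<open>f * Nm z\<close> a root of unity, the required \<open>zeta\<close>.\<close>

lemma fixed_class_norm_one:
  assumes "odd p" "u \<noteq> 0" "Nm u = 1" "tau u \<in> P"
  obtains zeta z where "zeta ^ p = 1" "z \<noteq> 0" "u = zeta * z ^ p / Nm z"
proof -
  obtain y where y: "y \<noteq> 0" "tau u = y ^ p" using assms(4) by (elim P_E)
  have "Nm y ^ p = 1" using Nm_tau[OF assms(2)] y(2) by (simp add: Nm_power)
  \<comment> \<open>Multiplying by \<open>Nm y\<close> brings \<open>tau u = y ^ p\<close> into the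
    form of \<open>twist_trivial\<close> with \<open>zeta = Nm y\<close>.\<close>
  moreover have "s u * Nm y = Nm y * u * y ^ p" using y(2) by (simp add: s_eq_tau mult_ac)
  ultimately have "Nm y = 1" using twist_trivial[OF assms(1,2) y(1) assms(3)] by blast
  then obtain z where z: "z \<noteq> 0" "y = tau z" using hilbert90[of y] by (auto simp: tau_def)
  let ?f = "u / z ^ p"
  have "tau ?f = 1" using y z by (simp add: tau_divide tau_power)
  then have fF: "?f \<in> F" by (rule tau_eq_1)
  have "u = ?f * z ^ p" using z(1) by simp
  then have "1 = Nm (?f * z ^ p)" using assms(3) by simp
  also have "\<dots> = (?f * Nm z) ^ p"
    by (simp only: Nm_mult Nm_power Nm_of_F[OF fF] power_mult_distrib)
  finally have "(?f * Nm z) ^ p = 1" by simp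
  moreover have "u = (?f * Nm z) * z ^ p / Nm z" using z(1) by simp
  ultimately show ?thesis using that z(1) by blast
qed

lemma tauk_Nm: "0 < k \<Longrightarrow> w \<noteq> 0 \<Longrightarrow> Nm ((tau ^^ k) w) = 1"
  by (cases k) (auto simp: Nm_tau)

lemma V_eq_normJ:
  assumes "2 \<le> k" "k \<le> p - 1"
  shows "V k = normJ_pre p s"
proof
  have odd: "odd p" using prime_odd_nat[OF prime_p] assms by linarith
  show "normJ_pre p s \<subseteq> V k" using V_antimono[OF assms(2)] V_norm by simp
  show "V k \<subseteq> normJ_pre p s"
  proof
    fix x assume "x \<in> V k"
    then obtain w y where *: "w \<noteq> 0" "y \<in> P" "x = (tau ^^ k) w * y" "tau ((tau ^^ k) w) \<in> P"
      by (elim V_E)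
    obtain l where l: "k = Suc l" "0 < l" using assms(1) by (cases k) auto
    let ?w = "(tau ^^ l) w" and ?u = "(tau ^^ k) w"
    obtain zeta z where z: "zeta ^ p = 1" "z \<noteq> 0" "?u = zeta * z ^ p / Nm z"
      using fixed_class_norm_one[OF odd _ _ *(4)] tauk_Nm[of k w] * l by auto
    have "s ?w = ?u * ?w" using l by (simp add: s_eq_tau)
    then have "s ?w * Nm z = zeta * ?w * z ^ p" using z by (simp add: mult_ac)
    then have "zeta = 1" using twist_trivial[OF odd _ z(2) _ z(1), of ?w] *(1) tauk_Nm[OF l(2) *(1)] by auto
    then have "x = Nm (inverse z) * (z ^ p * y)"
      using z *(3) by (simp add: Nm_inverse divide_inverse mult_ac)
    then show "x \<in> normJ_pre p s"
      unfolding normJ_pre_eq using z(2) *(2) P_mult[OF P_I[OF z(2)] *(2)]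
      by (metis (mono_tags, lifting) mem_Collect_eq inverse_nonzero_iff_nonzero)
  qed
qed

text \<open>The subgroup generated by \<open>xi\<close> and the norms, in the shape that
  \<open>fam_basis_quotient_adjoin\<close> expects.\<close>

definition xiN :: "'k set" where
  "xiN = {h * xi ^ c | h c. h \<in> normK p s}"

lemma xiN_I: "h \<in> normK p s \<Longrightarrow> h * xi ^ c \<in> xiN"
  by (auto simp: xiN_def)

lemma mult_subgroup_xiN: "mult_subgroup xiN"
  unfolding mult_subgroup_def
proof (intro conjI ballI)
  show "1 \<in> xiN" using xiN_I[of 1 0] mult_subgroupD(1)[OF mult_subgroup_normK] by simp
  show "0 \<notin> xiN" using mult_subgroupD(2)[OF mult_subgroup_normK] xi_ne0 by (auto simp: xiN_def)
next
  fix x y assume "x \<in> xiN" "y \<in> xiN"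
  then obtain h c k d where *: "h \<in> normK p s" "x = h * xi ^ c" "k \<in> normK p s" "y = k * xi ^ d"
    by (auto simp: xiN_def)
  have "x * y = (h * k) * xi ^ (c + d)" using * by (simp add: power_add mult_ac)
  then show "x * y \<in> xiN" using * xiN_I mult_subgroupD(3)[OF mult_subgroup_normK] by metis
next
  fix x assume "x \<in> xiN"
  then obtain h c where *: "h \<in> normK p s" "x = h * xi ^ c" by (auto simp: xiN_def)
  have "inverse x = inverse h * xi ^ (c * (p - 1))"
    using * inverse_unique[OF xi_pow_p_minus[of c]] by simp
  then show "inverse x \<in> xiN" using * xiN_I mult_subgroupD(4)[OF mult_subgroup_normK] by metis
qed

lemma normK_xiN: "normK p s \<subseteq> xiN"
  using xiN_I[of _ 0] by auto

lemma xiN_F: "xiN \<subseteq> F - {0}"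
  using normK_F xi_F xi_ne0 by (auto simp: xiN_def intro: F_closed F_power)

sublocale FxiN: Fp_quotient p "F - {0}" xiN
  by unfold_locales (use prime_p mult_subgroup_F mult_subgroup_xiN xiN_F FN.pow_U normK_xiN in blast)+

lemma xi_V1: "xi \<in> V 1"
  using alpha_ne0 P_1 tau_F[OF xi_F xi_ne0] by (intro V_I[of alpha 1]) (auto simp: tau_alpha)

lemma normJ_V1: "normJ_pre p s \<subseteq> V 1"
  using V_antimono[of 1 "p - 1"] V_norm p_gt1 by simp

lemma normJ_I: "h \<in> normK p s \<Longrightarrow> y \<in> P \<Longrightarrow> h * y \<in> normJ_pre p s"
  unfolding normJ_pre_eq normK_eq by blast

text \<open>For odd \<open>p\<close>, \<open>fixed_class_norm_one\<close> applies to
  \<open>tau w\<close>. For \<open>p = 2\<close> the index 1 is \<open>p - 1\<close>, so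
  \<open>V 1\<close> consists of norms times squares.\<close>

lemma V1_eq: "V 1 = {h * y | h y. h \<in> xiN \<and> y \<in> P}"
proof
  show "{h * y | h y. h \<in> xiN \<and> y \<in> P} \<subseteq> V 1"
  proof clarify
    fix h y assume "h \<in> xiN" "y \<in> P"
    then obtain k c where k: "k \<in> normK p s" "h = k * xi ^ c" by (auto simp: xiN_def)
    have "k * y \<in> V 1" using normJ_I[OF k(1) \<open>y \<in> P\<close>] normJ_V1 by blast
    then have "(k * y) * xi ^ c \<in> V 1"
      using mult_subgroup_V mult_subgroup_power[OF mult_subgroup_V xi_V1] mult_subgroupD(3) by blast
    then show "h * y \<in> V 1" using k(2) by (simp add: mult_ac)
  qed
  show "V 1 \<subseteq> {h * y | h y. h \<in> xiN \<and> y \<in> P}"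
  proof (cases "odd p")
    case False
    then have "p = 2" using prime_p primes_dvd_imp_eq two_is_prime_nat by blast
    then have "V 1 = normJ_pre p s" using V_norm by simp
    then show ?thesis unfolding normJ_pre_eq using normK_xiN normK_I by blast
  next
    case True
    show ?thesis
    proof
      fix x assume "x \<in> V 1"
      then obtain w y where *: "w \<noteq> 0" "y \<in> P" "x = tau w * y" "tau (tau w) \<in> P"
        by (elim V_E) auto
      obtain zeta z where z: "zeta ^ p = 1" "z \<noteq> 0" "tau w = zeta * z ^ p / Nm z"
        using fixed_class_norm_one[OF True _ Nm_tau *(4)] * by auto
      obtain c where c: "zeta = xi ^ c" using root_of_unity_is_xi_pow z(1) by blast
      have "x = (Nm (inverse z) * xi ^ c) * (z ^ p * y)"
        using z(3) *(3) c by (simp add: Nm_inverse divide_inverse mult_ac)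
      moreover have "Nm (inverse z) * xi ^ c \<in> xiN" using z(2) by (intro xiN_I normK_I) simp
      moreover have "z ^ p * y \<in> P" by (intro P_mult P_I z *)
      ultimately show "x \<in> {h * y | h y. h \<in> xiN \<and> y \<in> P}" by blast
    qed
  qed
qed

text \<open>By \<open>F_inter_P\<close> the element is a power of \<open>a\<close> times the p-th
  power of some \<open>g\<close> in \<open>F\<close>; the latter is the norm of \<open>g\<close>,
  and \<open>a\<close> is a norm up to a power of \<open>xi\<close>.\<close>

lemma F_inter_P_xiN:
  assumes "x \<in> F" "x \<in> P"
  shows "x \<in> xiN"
proof -
  obtain c g where g: "g \<in> F" "g \<noteq> 0" "x = a ^ c * g ^ p" using F_inter_P[OF assms] .
  obtain d where d: "a = Nm alpha * xi ^ d" using a_eq_norm by blast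
  have "a \<in> xiN" unfolding d by (intro xiN_I normK_I alpha_ne0)
  moreover have "g ^ p \<in> xiN" using FxiN.pow_U g by blast
  ultimately show ?thesis
    using g(3) mult_subgroup_xiN mult_subgroupD(3) mult_subgroup_power by metis
qed

text \<open>Together with \<open>xiN_V1\<close> this embeds \<open>F - {0}\<close> modulo
  \<open>xiN\<close> into \<open>V 0\<close> modulo \<open>V 1\<close>.\<close>

lemma F_inter_V1: "(F - {0}) \<inter> V 1 \<subseteq> xiN"
proof
  fix x assume x: "x \<in> (F - {0}) \<inter> V 1"
  then obtain h y where *: "h \<in> xiN" "y \<in> P" "x = h * y" unfolding V1_eq by blast
  have "h \<in> F - {0}" using *(1) xiN_F by blast
  then have "y \<in> F" using x *(3) mult_subgroup_cancel_left[OF mult_subgroup_F, of h y] by simp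
  then show "x \<in> xiN" using F_inter_P_xiN * mult_subgroup_xiN mult_subgroupD(3) by blast
qed

lemma xiN_V1: "xiN \<subseteq> V 1"
  unfolding V1_eq using P_1 by (metis (mono_tags, lifting) mem_Collect_eq mult.right_neutral subsetI)

section \<open>The top term \<open>V 0\<close>\<close>

lemma F_V0: "F - {0} \<subseteq> V 0"
  unfolding V_0 using tau_F P_1 by auto

lemma V0_norm_one:
  assumes "x \<noteq> 0" "tau x = y ^ p" "Nm y = 1"
  obtains f z where "f \<in> F - {0}" "z \<in> P" "x = f * z"
proof -
  obtain z where z: "z \<noteq> 0" "y = tau z" using hilbert90[OF assms(3)] by (auto simp: tau_def)
  have "tau (x / z ^ p) = 1" using assms(2) z by (simp add: tau_divide tau_power)
  then have "x / z ^ p \<in> F - {0}" using tau_eq_1 assms(1) z(1) by simp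
  moreover have "x = (x / z ^ p) * z ^ p" using z(1) by simp
  ultimately show ?thesis using that P_I[OF z(1)] by blast
qed

text \<open>The root of unity \<open>Nm y\<close> is the obstruction to \<open>x\<close> being an
  element of \<open>F\<close> times a p-th power: \<open>V0_norm_one\<close> handles the case where
  it is 1.\<close>

lemma V0_root:
  assumes "x \<in> V 0"
  obtains y c where "y \<noteq> 0" "tau x = y ^ p" "Nm y = xi ^ c"
proof -
  have x: "x \<noteq> 0" "tau x \<in> P" using assms by (auto simp: V_0)
  then obtain y where y: "y \<noteq> 0" "tau x = y ^ p" by (elim P_E)
  have "Nm y ^ p = 1" using Nm_tau[OF x(1)] y(2) by (simp add: Nm_power)
  then show ?thesis using root_of_unity_is_xi_pow that y by blast
qed

text \<open>The obstruction \<open>xi ^ c\<close> is a norm while \<open>xi\<close> is not, so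
  \<open>p dvd c\<close> by \<open>root_mem\<close> and the obstruction is trivial.\<close>

lemma V0_if_xi_not_norm:
  assumes "xi \<notin> normK p s" "x \<in> V 0"
  obtains f z where "f \<in> F - {0}" "z \<in> P" "x = f * z"
proof -
  obtain y c where y: "y \<noteq> 0" "tau x = y ^ p" "Nm y = xi ^ c" using V0_root[OF assms(2)] .
  have "xi ^ c \<in> normK p s" using y normK_I by metis
  then have "p dvd c"
    using FN.root_mem[OF mult_subgroup_normK order_refl, of xi c] assms(1) xi_F xi_ne0 by blast
  then have "Nm y = 1" using y(3) xi_pow_eq_1_iff by simp
  then show ?thesis using V0_norm_one[OF V_ne0[OF assms(2)] y(2)] that by blast
qed

text \<open>If \<open>xi = Nm y\<close>, then \<open>y ^ p\<close> has norm 1 and Hilbert 90 gives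
  \<open>x0\<close> with \<open>tau x0 = y ^ p\<close>, whose obstruction is \<open>xi\<close>.
  Dividing \<open>x\<close> by a suitable power of \<open>x0\<close> removes the obstruction of
  \<open>x\<close>.\<close>

lemma V0_if_xi_norm:
  assumes "xi \<in> normK p s"
  obtains x0 where "x0 \<in> V 0" "\<not> (\<exists>f\<in>F - {0}. \<exists>z\<in>P. x0 = f * z)"
    "\<And>x. x \<in> V 0 \<Longrightarrow> \<exists>f\<in>F - {0}. \<exists>z\<in>P. \<exists>n. x = f * z * x0 ^ n"
proof -
  obtain y where y: "y \<noteq> 0" "Nm y = xi" using assms unfolding normK_eq by blast
  have "Nm (y ^ p) = 1" using y xi_pow by (simp add: Nm_power)
  then obtain x0 where x0: "x0 \<noteq> 0" "y ^ p = tau x0" by (auto elim!: hilbert90 simp: tau_def)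
  show ?thesis
  proof (rule that[of x0])
    show "x0 \<in> V 0" using x0 P_I[OF y(1)] by (simp add: V_0)
    show "\<not> (\<exists>f\<in>F - {0}. \<exists>z\<in>P. x0 = f * z)"
    proof
      assume "\<exists>f\<in>F - {0}. \<exists>z\<in>P. x0 = f * z"
      then obtain f z where "f \<in> F" "f \<noteq> 0" "z \<in> P" "x0 = f * z" by blast
      then obtain t where t: "t \<noteq> 0" "x0 = f * t ^ p" by (auto elim: P_E)
      \<comment> \<open>As \<open>tau\<close> kills \<open>f\<close>, \<open>y\<close> and
        \<open>tau t\<close> differ by a power of \<open>xi\<close>, whose norm is 1; this would
        make \<open>Nm y\<close> equal to 1 instead of \<open>xi\<close>.\<close>
      have "y ^ p = tau t ^ p"
        unfolding x0(2) t(2) tau_mult tau_power tau_F[OF \<open>f \<in> F\<close> \<open>f \<noteq> 0\<close>] by simp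
      then have "(y / tau t) ^ p = 1" using t(1) by (simp add: power_divide)
      then obtain c where c: "y / tau t = xi ^ c" using root_of_unity_is_xi_pow by blast
      then have "y = xi ^ c * tau t" using t(1) by (simp add: field_simps)
      then have "Nm y = 1"
        using Nm_tau[OF t(1)] xi_pow by (simp add: Nm_mult Nm_power Nm_of_F[OF xi_F])
      then show False using y(2) xi_pow_eq_1_iff[of 1] p_gt1 by simp
    qed
    fix x assume x: "x \<in> V 0"
    obtain w c where w: "w \<noteq> 0" "tau x = w ^ p" "Nm w = xi ^ c" using V0_root[OF x] .
    let ?x = "x / x0 ^ c" and ?y = "w / y ^ c"
    have "(y ^ c) ^ p = tau x0 ^ c" by (metis x0(2) power_mult mult.commute)
    then have "tau ?x = ?y ^ p" using w(2) by (simp add: tau_divide tau_power power_divide)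
    moreover have "Nm ?y = 1"
      using w(3) y(2) xi_ne0 by (simp add: divide_inverse Nm_mult Nm_inverse Nm_power)
    ultimately obtain f z where "f \<in> F - {0}" "z \<in> P" "?x = f * z"
      using V0_norm_one[of ?x ?y] V_ne0[OF x] x0(1) by auto
    moreover have "x = ?x * x0 ^ c" using x0(1) by simp
    ultimately show "\<exists>f\<in>F - {0}. \<exists>z\<in>P. \<exists>n. x = f * z * x0 ^ n" by metis
  qed
qed

text \<open>If \<open>xi = Nm x * y\<close>, then \<open>y\<close> lies in \<open>F\<close> and is a
  p-th power, hence \<open>a ^ c * g ^ p\<close>. For odd \<open>p\<close> this is the norm of
  \<open>alpha ^ c * g\<close>, so \<open>xi\<close> would be a norm.\<close>

lemma xi_not_in_normJ:
  assumes "odd p" "xi \<notin> normK p s"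
  shows "xi \<notin> normJ_pre p s"
proof
  assume "xi \<in> normJ_pre p s"
  then obtain x y where *: "x \<noteq> 0" "y \<in> P" "xi = Nm x * y" unfolding normJ_pre_eq by blast
  have "y = xi / Nm x" using * by simp
  then have "y \<in> F" using F_closed(7) xi_F Nm_F by simp
  then obtain c g where g: "g \<in> F" "g \<noteq> 0" "y = a ^ c * g ^ p" using F_inter_P *(2) by metis
  have "xi = Nm (x * alpha ^ c * g)"
    using * g Nm_alpha_odd[OF assms(1)] by (simp add: Nm_mult Nm_power Nm_of_F mult_ac)
  then show False using assms(2) normK_I[of "x * alpha ^ c * g"] * g alpha_ne0 by simp
qed

section \<open>Cyclic submodules and decompositions\<close>

lemma cycsub_eq:
  assumes "g \<noteq> 0"
  shows "cycsub p s g = mspan P {..<p} (\<lambda>k. (s ^^ k) g)"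
proof (intro equalityI subsetI)
  fix x assume "x \<in> cycsub p s g"
  then show "x \<in> mspan P {..<p} (\<lambda>k. (s ^^ k) g)"
    unfolding cycsub_def using P_I by (auto intro!: mspanI[where T = "{..<p}"])
next
  fix x assume "x \<in> mspan P {..<p} (\<lambda>k. (s ^^ k) g)"
  then obtain h T e where x: "h \<in> P" "T \<subseteq> {..<p}" "x = h * (\<Prod>k\<in>T. ((s ^^ k) g) ^ (e k::nat))"
    by (elim mspanE)
  obtain y where y: "y \<noteq> 0" "h = y ^ p" using x(1) by (elim P_E)
  have "(\<Prod>k\<in>T. ((s ^^ k) g) ^ e k) = (\<Prod>k<p. ((s ^^ k) g) ^ (if k \<in> T then e k else 0))"
    using x(2) by (intro prod.mono_neutral_cong_left) auto
  then show "x \<in> cycsub p s g"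
    unfolding cycsub_def using x(3) y
    by (intro CollectI exI[of _ y] exI[of _ "\<lambda>k. if k \<in> T then e k else 0"]) simp
qed

lemma mult_subgroup_cycsub: "g \<noteq> 0 \<Longrightarrow> mult_subgroup (cycsub p s g)"
  unfolding cycsub_eq by (intro J.mspan_subgroup) auto

lemma P_subset_cycsub: "g \<noteq> 0 \<Longrightarrow> P \<subseteq> cycsub p s g"
  unfolding cycsub_eq by (rule J.mspan_base)

lemma sk_cycsub:
  assumes "g \<noteq> 0"
  shows "(s ^^ k) g \<in> cycsub p s g"
proof -
  have "(s ^^ (p * q)) x = x" for q x
    by (induction q) (auto simp: funpow_add s_period)
  then have "(s ^^ (k mod p + p * (k div p))) g = (s ^^ (k mod p)) g"
    by (simp only: funpow_add o_apply)
  then have "(s ^^ k) g = (s ^^ (k mod p)) g" by simp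
  then show ?thesis
    unfolding cycsub_eq[OF assms] using J.mspan_gen[of "k mod p" "{..<p}" "\<lambda>k. (s ^^ k) g"] p_pos by simp
qed

lemma cycsub_least:
  assumes "g \<noteq> 0" "mult_subgroup G" "P \<subseteq> G" "\<And>k. (s ^^ k) g \<in> G"
  shows "cycsub p s g \<subseteq> G"
  unfolding cycsub_eq[OF assms(1)] using assms by (intro J.mspan_least) auto

text \<open>The elements that \<open>s\<close> sends into the submodule form a subgroup containing
  \<open>P\<close> and all generators, so minimality applies.\<close>

lemma s_cycsub:
  assumes "g \<noteq> 0" "x \<in> cycsub p s g"
  shows "s x \<in> cycsub p s g"
proof -
  have "cycsub p s g \<subseteq> {x. x \<noteq> 0 \<and> s x \<in> cycsub p s g}"
  proof (rule cycsub_least[OF assms(1)])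
    show "mult_subgroup {x. x \<noteq> 0 \<and> s x \<in> cycsub p s g}"
      using mult_subgroup_cycsub[OF assms(1)] by (intro mult_subgroup_vimage) (auto simp: s_mult s_inverse)
    show "P \<subseteq> {x. x \<noteq> 0 \<and> s x \<in> cycsub p s g}"
      using P_subset_cycsub[OF assms(1)] s_P P_ne0 by blast
    show "(s ^^ k) g \<in> {x. x \<noteq> 0 \<and> s x \<in> cycsub p s g}" for k
      using sk_cycsub[OF assms(1), of "Suc k"] assms(1) by simp
  qed
  then show ?thesis using assms(2) by blast
qed

lemma tauk_cycsub:
  assumes "g \<noteq> 0" "x \<in> cycsub p s g"
  shows "(tau ^^ k) x \<in> cycsub p s g"
proof (induction k)
  case (Suc k)
  then show ?case
    using mult_subgroupD(5)[OF mult_subgroup_cycsub[OF assms(1)] s_cycsub[OF assms(1)]]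
    by (simp add: tau_def)
qed (use assms in simp)

lemma tauk_s: "(tau ^^ l) (s x) = s ((tau ^^ l) x)"
  by (induction l) (auto simp: tau_def s_divide)

text \<open>The classes killed by \<open>tau ^^ l\<close> form a subgroup stable under
  \<open>s\<close>, so it is enough to kill the generator.\<close>

lemma tauk_cycsub_in_P:
  assumes "g \<noteq> 0" "(tau ^^ l) g \<in> P" "x \<in> cycsub p s g"
  shows "(tau ^^ l) x \<in> P"
proof -
  have "cycsub p s g \<subseteq> {x. x \<noteq> 0 \<and> (tau ^^ l) x \<in> P}"
  proof (rule cycsub_least[OF assms(1)])
    show "mult_subgroup {x. x \<noteq> 0 \<and> (tau ^^ l) x \<in> P}"
      using mult_subgroup_P by (intro mult_subgroup_vimage) (auto simp: tauk_mult tauk_inverse)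
    show "P \<subseteq> {x. x \<noteq> 0 \<and> (tau ^^ l) x \<in> P}" using tauk_P P_ne0 by blast
    have "(tau ^^ l) ((s ^^ k) g) \<in> P" for k
      using assms(2) by (induction k) (auto simp: tauk_s s_P)
    then show "(s ^^ k) g \<in> {x. x \<noteq> 0 \<and> (tau ^^ l) x \<in> P}" for k using assms(1) by simp
  qed
  then show ?thesis using assms(3) by blast
qed

section \<open>Length and socle of a cyclic module\<close>

lemma tauk_ge_in_P:
  assumes "(tau ^^ l) g \<in> P" "l \<le> m"
  shows "(tau ^^ m) g \<in> P"
proof -
  have "(tau ^^ m) g = (tau ^^ (m - l)) ((tau ^^ l) g)"
    using assms(2) by (metis comp_apply funpow_add le_add_diff_inverse2)
  then show ?thesis using tauk_P[OF assms(1)] by simp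
qed

text \<open>Apply the power of \<open>tau\<close> that moves the first index with a nonzero exponent to \<open>l - 1\<close>.\<close>

lemma tauk_independent:
  assumes "g \<noteq> 0" "(tau ^^ l) g \<in> P" "\<And>m. m < l \<Longrightarrow> (tau ^^ m) g \<notin> P"
    and "S \<subseteq> {..<l}" "(\<Prod>m\<in>S. (tau ^^ m) g ^ e m) \<in> P" "m \<in> S"
  shows "p dvd e m"
proof (rule ccontr)
  assume "\<not> p dvd e m"
  define m0 where "m0 = (LEAST m. m \<in> S \<and> \<not> p dvd e m)"
  have m0: "m0 \<in> S" "\<not> p dvd e m0"
    using LeastI[of "\<lambda>m. m \<in> S \<and> \<not> p dvd e m" m] assms(6) \<open>\<not> p dvd e m\<close> unfolding m0_def by auto
  have min: "p dvd e k" if "k \<in> S" "k < m0" for k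
    using not_less_Least[of k "\<lambda>m. m \<in> S \<and> \<not> p dvd e m"] that unfolding m0_def by blast
  have "finite S" using assms(4) finite_subset by blast
  \<comment> \<open>After \<open>tau ^^ d\<close>, indices above \<open>m0\<close> reach
    \<open>l\<close> and give p-th powers, while those below have exponents divisible by
    \<open>p\<close>. Only the term at \<open>m0\<close>, now at index \<open>l - 1\<close>,
    remains.\<close>
  define d where "d = l - 1 - m0"
  have m0l: "m0 < l" using m0(1) assms(4) by blast
  have "(tau ^^ d) (\<Prod>m\<in>S. (tau ^^ m) g ^ e m) = (\<Prod>m\<in>S. (tau ^^ (d + m)) g ^ e m)"
    by (simp add: tauk_prod tauk_power funpow_add)
  also have "\<dots> = (tau ^^ (d + m0)) g ^ e m0 * (\<Prod>m\<in>S - {m0}. (tau ^^ (d + m)) g ^ e m)"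
    using \<open>finite S\<close> m0(1) by (rule prod.remove)
  finally have "(\<Prod>m\<in>S - {m0}. (tau ^^ (d + m)) g ^ e m) * (tau ^^ (d + m0)) g ^ e m0 \<in> P"
    using tauk_P[OF assms(5), of d] by (simp add: mult.commute)
  moreover have "(\<Prod>m\<in>S - {m0}. (tau ^^ (d + m)) g ^ e m) \<in> P"
  proof (rule mult_subgroup_prod[OF mult_subgroup_P])
    fix k assume k: "k \<in> S - {m0}"
    show "(tau ^^ (d + k)) g ^ e k \<in> P"
    proof (cases "k < m0")
      case True
      then show ?thesis using min k assms(1) by (intro J.pow_dvd_mem) auto
    next
      case False
      then have "l \<le> d + k" using k m0l unfolding d_def by auto
      then show ?thesis using tauk_ge_in_P[OF assms(2)] mult_subgroup_power[OF mult_subgroup_P] by blast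
    qed
  qed
  ultimately have "(tau ^^ (d + m0)) g ^ e m0 \<in> P"
    using mult_subgroup_cancel_left[OF mult_subgroup_P] by blast
  then have "(tau ^^ (d + m0)) g \<in> P"
    using J.root_mem[OF mult_subgroup_P order_refl _ _ m0(2)] assms(1) by simp
  moreover have "d + m0 < l" using m0l unfolding d_def by simp
  ultimately show False using assms(3) by blast
qed

text \<open>By the binomial expansion each \<open>s ^^ k\<close> is a polynomial in
  \<open>tau\<close>, so the powers of \<open>tau\<close> span; those from \<open>l\<close> on are
  trivial on \<open>g\<close>, and the first \<open>l\<close> are independent.\<close>

lemma cycsub_fam_basis:
  assumes "g \<noteq> 0" "(tau ^^ l) g \<in> P" "\<And>m. m < l \<Longrightarrow> (tau ^^ m) g \<notin> P"
  shows "fam_basis p (cycsub p s g) P {..<l} (\<lambda>m. (tau ^^ m) g)"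
  unfolding fam_basis_def
proof (intro conjI allI impI)
  let ?G = "mspan P {..<l} (\<lambda>m. (tau ^^ m) g)"
  show "(\<lambda>m. (tau ^^ m) g) ` {..<l} \<subseteq> cycsub p s g"
    using tauk_cycsub[OF assms(1) sk_cycsub[OF assms(1), of 0]] by auto
  have G: "mult_subgroup ?G" using assms(1) by (intro J.mspan_subgroup) auto
  have gen: "(tau ^^ m) g \<in> ?G" for m
  proof (cases "m < l")
    case True
    then show ?thesis using J.mspan_gen[of m "{..<l}" "\<lambda>m. (tau ^^ m) g"] by simp
  next
    case False
    then show ?thesis using tauk_ge_in_P[OF assms(2)] J.mspan_base by (meson not_less subsetD)
  qed
  show "cycsub p s g \<subseteq> ?G"
  proof (rule cycsub_least[OF assms(1) G J.mspan_base])
    fix k show "(s ^^ k) g \<in> ?G"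
      unfolding sk_tau_binomial using gen by (intro mult_subgroup_prod[OF G] mult_subgroup_power[OF G])
  qed
  fix S e assume "finite S \<and> S \<subseteq> {..<l} \<and> (\<Prod>m\<in>S. (tau ^^ m) g ^ e m) \<in> P"
  then show "\<forall>m\<in>S. p dvd e m" using tauk_independent[OF assms] by blast
qed

text \<open>The least power of \<open>tau\<close> killing the class of \<open>g\<close> is the size
  of the basis in \<open>cycsub_fam_basis\<close>, hence the dimension.\<close>

lemma cycsub_length:
  assumes "g \<noteq> 0" "finite B" "Fp_basis p (cycsub p s g) P B"
  shows "(tau ^^ card B) g \<in> P" "m < card B \<Longrightarrow> (tau ^^ m) g \<notin> P"
proof -
  define l where "l = (LEAST m. (tau ^^ m) g \<in> P)"
  have l: "(tau ^^ l) g \<in> P" unfolding l_def by (rule LeastI) (rule tau_p_in_P[OF assms(1)])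
  have min: "m < l \<Longrightarrow> (tau ^^ m) g \<notin> P" for m using not_less_Least unfolding l_def by blast
  interpret Q: Fp_quotient p "cycsub p s g" P
    by unfold_locales (use prime_p mult_subgroup_cycsub[OF assms(1)] mult_subgroup_P
      P_subset_cycsub[OF assms(1)] P_I mult_subgroupD(2)[OF mult_subgroup_cycsub[OF assms(1)]] in auto)
  have "{..<l} \<approx> B"
    using Q.fam_basis_eqpoll[OF cycsub_fam_basis[OF assms(1) l min] Q.Fp_basis_fam_basis[OF assms(3)]] by blast
  then have "card B = l" using assms(2) eqpoll_iff_card[of "{..<l}" B] by simp
  then show "(tau ^^ card B) g \<in> P" "m < card B \<Longrightarrow> (tau ^^ m) g \<notin> P" using l min by auto
qed

text \<open>Expand \<open>x\<close> in the powers of \<open>tau\<close>. Applying \<open>tau\<close>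
  shifts the indices by one and kills the top term, so independence makes the exponents below
  \<open>l\<close> divisible by \<open>p\<close>.\<close>

lemma cycsub_socle:
  assumes "g \<noteq> 0" "(tau ^^ Suc l) g \<in> P" "\<And>m. m < Suc l \<Longrightarrow> (tau ^^ m) g \<notin> P"
    and "x \<in> cycsub p s g" "tau x \<in> P"
  obtains n h where "h \<in> P" "x = h * (tau ^^ l) g ^ n"
proof -
  obtain h T e where x: "h \<in> P" "finite T" "T \<subseteq> {..<Suc l}" "x = h * (\<Prod>m\<in>T. (tau ^^ m) g ^ (e m::nat))"
    by (rule mspanE[OF fam_basisD(2)[OF cycsub_fam_basis[OF assms(1,2)] assms(4)]])
      (use assms(3) in auto)
  let ?T = "T - {l}"
  have "tau x = tau h * (\<Prod>m\<in>T. (tau ^^ Suc m) g ^ e m)"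
    using x(4) by (simp add: tau_mult tau_prod tau_power)
  then have T: "(\<Prod>m\<in>T. (tau ^^ Suc m) g ^ e m) \<in> P"
    using mult_subgroup_cancel_left[OF mult_subgroup_P tau_P[OF x(1)]] assms(5) by metis
  have T': "(\<Prod>m\<in>?T. (tau ^^ Suc m) g ^ e m) \<in> P"
  proof (cases "l \<in> T")
    case True
    then have "(tau ^^ Suc l) g ^ e l * (\<Prod>m\<in>?T. (tau ^^ Suc m) g ^ e m) \<in> P"
      using T prod.remove[OF x(2) True, of "\<lambda>m. (tau ^^ Suc m) g ^ e m"] by simp
    then show ?thesis
      using mult_subgroup_cancel_left[OF mult_subgroup_P mult_subgroup_power[OF mult_subgroup_P assms(2)]] by blast
  qed (use T in simp)
  \<comment> \<open>The shifted indices stay below \<open>Suc l\<close>, where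
    \<open>tauk_independent\<close> applies.\<close>
  have "(\<Prod>m\<in>Suc ` ?T. (tau ^^ m) g ^ e (m - 1)) \<in> P"
    using T' by (subst prod.reindex) auto
  then have "p dvd e (m - 1)" if "m \<in> Suc ` ?T" for m
    using x(3) that by (intro tauk_independent[OF assms(1-3), where S = "Suc ` ?T" and e = "\<lambda>m. e (m - 1)"]) auto
  then have dvd: "p dvd e m" if "m \<in> ?T" for m using that by fastforce
  have "(\<Prod>m\<in>?T. (tau ^^ m) g ^ e m) \<in> P"
    using dvd assms(1) by (intro mult_subgroup_prod[OF mult_subgroup_P] J.pow_dvd_mem) auto
  then have hP: "h * (\<Prod>m\<in>?T. (tau ^^ m) g ^ e m) \<in> P" using P_mult x(1) by blast
  show ?thesis
  proof (cases "l \<in> T")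
    case True
    then have "x = h * (\<Prod>m\<in>?T. (tau ^^ m) g ^ e m) * (tau ^^ l) g ^ e l"
      using x(4) prod.remove[OF x(2) True, of "\<lambda>m. (tau ^^ m) g ^ e m"] by (simp add: mult_ac)
    then show ?thesis using that hP by blast
  next
    case False
    then have "x = h * (\<Prod>m\<in>?T. (tau ^^ m) g ^ e m) * (tau ^^ l) g ^ 0" using x(4) by simp
    then show ?thesis using that hP by blast
  qed
qed

end

section \<open>A given decomposition of \<open>J\<close>, compared with the filtration\<close>

locale kummer_decomposition = kummer_cyclic p F xi a alpha s
  for p :: nat and F :: "'k::field set" and xi a alpha :: 'k and s :: "'k \<Rightarrow> 'k" +
  fixes Kset :: "nat \<Rightarrow> 'j set" and M :: "nat \<Rightarrow> 'j \<Rightarrow> 'k set"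
  assumes decomp: "Jdecomp p s Kset M"
begin

lemma decomp_span:
  assumes "x \<noteq> 0"
  obtains S w y where "finite S" "S \<subseteq> Sigma {1..p} Kset" "y \<in> P"
    "\<And>i j. (i, j) \<in> S \<Longrightarrow> w (i, j) \<in> M i j" "x = y * (\<Prod>ij\<in>S. w ij)"
proof -
  have "\<forall>x. x \<noteq> 0 \<longrightarrow> (\<exists>S w y. finite S \<and> S \<subseteq> Sigma {1..p} Kset \<and> y \<noteq> 0 \<and>
      (\<forall>ij\<in>S. w ij \<in> M (fst ij) (snd ij)) \<and> x = y ^ p * (\<Prod>ij\<in>S. w ij))"
    using decomp unfolding Jdecomp_def by (elim conjE)
  from this[rule_format, OF assms]
  obtain S w y where "finite S" "S \<subseteq> Sigma {1..p} Kset" "y \<noteq> 0"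
      "\<forall>ij\<in>S. w ij \<in> M (fst ij) (snd ij)" "x = y ^ p * (\<Prod>ij\<in>S. w ij)" by blast
  then show ?thesis using P_I by (intro that[of S "y ^ p" w]) auto
qed

lemma decomp_indep:
  assumes "finite S" "S \<subseteq> Sigma {1..p} Kset" "\<And>i j. (i, j) \<in> S \<Longrightarrow> w (i, j) \<in> M i j"
    "(\<Prod>ij\<in>S. w ij) \<in> P" "ij \<in> S"
  shows "w ij \<in> P"
proof -
  have "\<forall>S w. finite S \<and> S \<subseteq> Sigma {1..p} Kset \<and> (\<forall>ij\<in>S. w ij \<in> M (fst ij) (snd ij)) \<and>
        (\<Prod>ij\<in>S. w ij) \<in> P \<longrightarrow> (\<forall>ij\<in>S. w ij \<in> P)"
    using decomp unfolding Jdecomp_def by (elim conjE)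
  moreover have "\<forall>ij\<in>S. w ij \<in> M (fst ij) (snd ij)" using assms(3) by auto
  ultimately have "\<forall>ij\<in>S. w ij \<in> P" using assms(1,2,4) by simp
  then show ?thesis using assms(5) by blast
qed

text \<open>One fixed generator per summand turns the socle vectors into a family indexed by
  \<open>Kset\<close>.\<close>

definition gen :: "nat \<Rightarrow> 'j \<Rightarrow> 'k" where
  "gen i j = (SOME g. g \<noteq> 0 \<and> M i j = cycsub p s g)"

lemma
  assumes "i \<in> {1..p}" "j \<in> Kset i"
  shows gen_ne0: "gen i j \<noteq> 0" and M_eq: "M i j = cycsub p s (gen i j)"
    and tau_gen_in_P: "(tau ^^ i) (gen i j) \<in> P"
    and tau_gen_notin_P: "\<And>m. m < i \<Longrightarrow> (tau ^^ m) (gen i j) \<notin> P"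
proof -
  have "\<forall>i\<in>{1..p}. \<forall>j\<in>Kset i. (\<exists>g. g \<noteq> 0 \<and> M i j = cycsub p s g) \<and>
      (\<exists>B. finite B \<and> card B = i \<and> Fp_basis p (M i j) P B)"
    using decomp unfolding Jdecomp_def by (elim conjE)
  from bspec[OF bspec[OF this assms(1)] assms(2)]
  have ex: "\<exists>g. g \<noteq> 0 \<and> M i j = cycsub p s g"
    and B: "\<exists>B. finite B \<and> card B = i \<and> Fp_basis p (M i j) P B" by auto
  show g: "gen i j \<noteq> 0" "M i j = cycsub p s (gen i j)"
    using someI_ex[OF ex] unfolding gen_def by blast+
  obtain B where "finite B" "card B = i" "Fp_basis p (M i j) P B" using B by blast
  then show "(tau ^^ i) (gen i j) \<in> P" "\<And>m. m < i \<Longrightarrow> (tau ^^ m) (gen i j) \<notin> P"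
    using cycsub_length[OF g(1), of B] g(2) by auto
qed

lemma mult_subgroup_M: "i \<in> {1..p} \<Longrightarrow> j \<in> Kset i \<Longrightarrow> mult_subgroup (M i j)"
  by (simp add: M_eq mult_subgroup_cycsub gen_ne0)

lemma tauk_M: "i \<in> {1..p} \<Longrightarrow> j \<in> Kset i \<Longrightarrow> x \<in> M i j \<Longrightarrow> (tau ^^ k) x \<in> M i j"
  by (simp add: M_eq tauk_cycsub gen_ne0)

lemma tauk_M_in_P:
  assumes "i \<in> {1..p}" "j \<in> Kset i" "x \<in> M i j" "i \<le> k"
  shows "(tau ^^ k) x \<in> P"
  using tauk_cycsub_in_P[OF gen_ne0 tauk_ge_in_P[OF tau_gen_in_P assms(4)]] assms M_eq by blast

lemma gen_V:
  assumes "Suc k \<in> {1..p}" "j \<in> Kset (Suc k)" "l \<le> k"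
  shows "(tau ^^ k) (gen (Suc k) j) \<in> V l"
proof -
  have "(tau ^^ k) (gen (Suc k) j) \<in> V k"
    using gen_ne0[OF assms(1,2)] tau_gen_in_P[OF assms(1,2)] P_1 by (intro V_I[of _ 1]) auto
  then show ?thesis using V_antimono[OF assms(3)] by blast
qed

text \<open>In components: \<open>tau ^^ k\<close> kills summands of dimension at most
  \<open>k\<close>, and socles of summands longer than \<open>k + 1\<close> lie in
  \<open>V (Suc k)\<close>, so those of dimension \<open>k + 1\<close> span. They are independent
  because \<open>tau ^^ Suc k\<close> is trivial on them.\<close>

lemma V_fam_basis:
  assumes "k < p"
  shows "fam_basis p (V k) (V (Suc k)) (Kset (Suc k)) (\<lambda>j. (tau ^^ k) (gen (Suc k) j))"
  unfolding fam_basis_def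
proof (intro conjI allI impI)
  let ?b = "\<lambda>j. (tau ^^ k) (gen (Suc k) j)"
  have k: "Suc k \<in> {1..p}" using assms by simp
  show bV: "?b ` Kset (Suc k) \<subseteq> V k" using gen_V[OF k] by blast
  interpret Q: Fp_quotient p "V k" "V (Suc k)" by (rule Fp_quotient_V) simp
  have G: "mult_subgroup (mspan (V (Suc k)) (Kset (Suc k)) ?b)" by (rule Q.mspan_subgroup[OF bV])
  have PG: "P \<subseteq> mspan (V (Suc k)) (Kset (Suc k)) ?b" using P_subset_V Q.mspan_base by blast
  show "V k \<subseteq> mspan (V (Suc k)) (Kset (Suc k)) ?b"
  proof
    fix x assume "x \<in> V k"
    then obtain w y where w: "w \<noteq> 0" "y \<in> P" "x = (tau ^^ k) w * y" "tau ((tau ^^ k) w) \<in> P"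
      by (elim V_E)
    obtain S c z where S: "finite S" "S \<subseteq> Sigma {1..p} Kset" "z \<in> P"
      "\<And>i j. (i, j) \<in> S \<Longrightarrow> c (i, j) \<in> M i j" "w = z * (\<Prod>ij\<in>S. c ij)" by (rule decomp_span[OF w(1)]) (rule that)
    let ?d = "\<lambda>ij. (tau ^^ k) (c ij)"
    have dM: "?d (i, j) \<in> M i j" if "(i, j) \<in> S" for i j
      using that S(2,4) by (intro tauk_M) auto
    have tw: "(tau ^^ k) w = (tau ^^ k) z * (\<Prod>ij\<in>S. ?d ij)" using S(5) by (simp add: tauk_mult tauk_prod)
    then have "tau ((tau ^^ k) z) * (\<Prod>ij\<in>S. tau (?d ij)) \<in> P" using w(4) by (simp add: tau_mult tau_prod)
    then have "(\<Prod>ij\<in>S. tau (?d ij)) \<in> P"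
      using mult_subgroup_cancel_left[OF mult_subgroup_P tau_P[OF tauk_P[OF S(3)]]] by blast
    moreover have "tau (?d (i, j)) \<in> M i j" if "(i, j) \<in> S" for i j
      using that S(2) dM tauk_M[of i j _ 1] by auto
    \<comment> \<open>Directness of the sum makes every component a fixed class by itself, so that
      it lies in the socle of its summand.\<close>
    ultimately have td: "tau (?d ij) \<in> P" if "ij \<in> S" for ij
      using decomp_indep[OF S(1,2), of "\<lambda>ij. tau (?d ij)"] that by blast
    have "?d ij \<in> mspan (V (Suc k)) (Kset (Suc k)) ?b" if ijS: "ij \<in> S" for ij
    proof -
      obtain i j where ij: "ij = (i, j)" "i \<in> {1..p}" "j \<in> Kset i" "(i, j) \<in> S"
        using ijS S(2) by (cases ij) auto
      obtain l where l: "i = Suc l" using ij(2) by (cases i) auto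
      have l': "Suc l \<in> {1..p}" "j \<in> Kset (Suc l)" using ij l by auto
      obtain h n where hn: "h \<in> P" "?d ij = h * (tau ^^ l) (gen i j) ^ n"
        using cycsub_socle[OF gen_ne0[OF l'] tau_gen_in_P[OF l'] tau_gen_notin_P[OF l'], of "?d ij"]
          td[OF ijS] dM[OF ij(4)] M_eq[OF l'] ij(1) l by (metis (no_types, lifting))
      consider "i \<le> k" | "i = Suc k" | "k < l" using l by linarith
      then show ?thesis
      proof cases
        case 1
        then show ?thesis using tauk_M_in_P[OF ij(2,3)] S(4)[OF ij(4)] ij(1) PG by blast
      next
        case 2
        then have "(tau ^^ l) (gen i j) \<in> mspan (V (Suc k)) (Kset (Suc k)) ?b"
          using Q.mspan_gen[of j "Kset (Suc k)" ?b] ij(3) l by simp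
        then show ?thesis
          unfolding hn(2) using hn(1) PG mult_subgroupD(3)[OF G] mult_subgroup_power[OF G] by blast
      next
        case 3
        then have "(tau ^^ l) (gen i j) \<in> V (Suc k)" using gen_V[OF l', of "Suc k"] l by simp
        then have "(tau ^^ l) (gen i j) \<in> mspan (V (Suc k)) (Kset (Suc k)) ?b" using Q.mspan_base by blast
        then show ?thesis
          unfolding hn(2) using hn(1) PG mult_subgroupD(3)[OF G] mult_subgroup_power[OF G] by blast
      qed
    qed
    then have "(\<Prod>ij\<in>S. ?d ij) \<in> mspan (V (Suc k)) (Kset (Suc k)) ?b" by (rule mult_subgroup_prod[OF G])
    then show "x \<in> mspan (V (Suc k)) (Kset (Suc k)) ?b"
      unfolding w(3) tw using w(2) tauk_P[OF S(3)] PG mult_subgroupD(3)[OF G] by blast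
  qed
  fix S e assume S: "finite S \<and> S \<subseteq> Kset (Suc k) \<and> (\<Prod>j\<in>S. ?b j ^ e j) \<in> V (Suc k)"
  then obtain w y where w: "w \<noteq> 0" "y \<in> P" "(\<Prod>j\<in>S. ?b j ^ e j) = (tau ^^ Suc k) w * y"
    by (elim conjE V_E)
  obtain T c z where T: "finite T" "T \<subseteq> Sigma {1..p} Kset" "z \<in> P"
    "\<And>i j. (i, j) \<in> T \<Longrightarrow> c (i, j) \<in> M i j" "w = z * (\<Prod>ij\<in>T. c ij)" by (rule decomp_span[OF w(1)]) (rule that)
  let ?S = "Pair (Suc k) ` S"
  \<comment> \<open>Both sides are extended by 1 to a common index set, so that their quotient is
    one product of components to which directness applies.\<close>
  let ?u = "\<lambda>ij. if ij \<in> ?S then ?b (snd ij) ^ e (snd ij) else 1"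
  let ?v = "\<lambda>ij. if ij \<in> T then (tau ^^ Suc k) (c ij) else 1"
  have Q: "finite (?S \<union> T)" "?S \<union> T \<subseteq> Sigma {1..p} Kset" using S T(1,2) k by auto
  have "(\<Prod>ij\<in>?S \<union> T. ?u ij) = (\<Prod>j\<in>S. ?b j ^ e j)"
  proof -
    have "(\<Prod>ij\<in>?S \<union> T. ?u ij) = (\<Prod>ij\<in>?S. ?b (snd ij) ^ e (snd ij))"
      using Q by (intro prod.mono_neutral_cong_right) auto
    then show ?thesis by (simp add: prod.reindex inj_on_def)
  qed
  moreover have "(\<Prod>ij\<in>?S \<union> T. ?v ij) = (\<Prod>ij\<in>T. (tau ^^ Suc k) (c ij))"
    using Q by (intro prod.mono_neutral_cong_right) auto
  moreover have "(tau ^^ Suc k) w = (tau ^^ Suc k) z * (\<Prod>ij\<in>T. (tau ^^ Suc k) (c ij))"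
    using T(5) by (simp only: tauk_mult tauk_prod)
  moreover have "(\<Prod>ij\<in>T. (tau ^^ Suc k) (c ij)) \<noteq> 0"
    using w(1) T(1,5) by auto
  ultimately have "(\<Prod>ij\<in>?S \<union> T. ?u ij / ?v ij) = (tau ^^ Suc k) z * y"
    using w(3) by (simp only: prod_dividef) (simp del: funpow.simps)
  then have "(\<Prod>ij\<in>?S \<union> T. ?u ij / ?v ij) \<in> P"
    using P_mult[OF tauk_P[OF T(3)] w(2)] by (simp only:)
  moreover have "?u (i, j) / ?v (i, j) \<in> M i j" if "(i, j) \<in> ?S \<union> T" for i j
  proof -
    have ij: "i \<in> {1..p}" "j \<in> Kset i" using that Q(2) by auto
    note sub = mult_subgroup_M[OF ij]
    have "?u (i, j) \<in> M i j"
      using tauk_cycsub[OF gen_ne0[OF ij] sk_cycsub[OF gen_ne0[OF ij], of 0], of k] M_eq[OF ij]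
        mult_subgroup_power[OF sub] mult_subgroupD(1)[OF sub] by auto
    moreover have "?v (i, j) \<in> M i j"
      using T(4) tauk_M[OF ij] mult_subgroupD(1)[OF sub] by (auto simp del: funpow.simps)
    ultimately show ?thesis by (rule mult_subgroupD(5)[OF sub])
  qed
  ultimately have uv: "?u ij / ?v ij \<in> P" if "ij \<in> ?S \<union> T" for ij
    using decomp_indep[OF Q, of "\<lambda>ij. ?u ij / ?v ij"] that by blast
  show "\<forall>j\<in>S. p dvd e j"
  proof (rule ballI, rule ccontr)
    fix j assume j: "j \<in> S" and e: "\<not> p dvd e j"
    have jK: "j \<in> Kset (Suc k)" using j S by blast
    \<comment> \<open>The summand has dimension \<open>k + 1\<close>, so \<open>tau ^^ Suc k\<close>
      leaves no contribution in it and \<open>?b j ^ e j\<close> must be trivial alone.\<close>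
    have "?v (Suc k, j) \<in> P"
      using T(4)[of "Suc k" j] tauk_M_in_P[OF k jK] P_1 by (auto simp del: funpow.simps)
    moreover have "?u (Suc k, j) / ?v (Suc k, j) \<in> P" using uv j by blast
    ultimately have "?v (Suc k, j) * (?u (Suc k, j) / ?v (Suc k, j)) \<in> P" using P_mult by blast
    moreover have "?v (Suc k, j) \<noteq> 0" using \<open>?v (Suc k, j) \<in> P\<close> P_ne0 by blast
    ultimately have "?u (Suc k, j) \<in> P" by simp
    then have "?b j ^ e j \<in> P" using j by simp
    then have "?b j \<in> P"
      using J.root_mem[OF mult_subgroup_P order_refl _ _ e] gen_ne0[OF k jK] by simp
    then show False using tau_gen_notin_P[OF k jK, of k] by simp
  qed
qed

section \<open>Counting the summands of each dimension\<close>

lemma Kset_eqpoll: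
  assumes "k < p" "fam_basis p (V k) (V (Suc k)) I b"
  shows "Kset (Suc k) \<approx> I"
proof -
  interpret Q: Fp_quotient p "V k" "V (Suc k)" by (rule Fp_quotient_V) simp
  show ?thesis by (rule Q.fam_basis_eqpoll[OF V_fam_basis[OF assms(1)] assms(2)])
qed

lemma Kset_p:
  assumes "Fp_basis p (normJ_pre p s) P B"
  shows "Kset p \<approx> B"
proof -
  interpret Q: Fp_quotient p "V (p - 1)" "V p" by (rule Fp_quotient_V) simp
  have "fam_basis p (V (p - 1)) (V (Suc (p - 1))) B (\<lambda>x. x)"
    using Q.Fp_basis_fam_basis[of B] assms p_pos unfolding V_norm V_p by (simp add: V_p)
  then show ?thesis using Kset_eqpoll[of "p - 1" B] p_pos by simp
qed

lemma Kset_middle: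
  assumes "3 \<le> i" "i \<le> p - 1"
  shows "Kset i = {}"
proof -
  obtain k where k: "i = Suc k" "2 \<le> k" using assms by (cases i) auto
  interpret Q: Fp_quotient p "V k" "V (Suc k)" by (rule Fp_quotient_V) simp
  \<comment> \<open>From \<open>3 \<le> i \<le> p - 1\<close> both \<open>k\<close> and
    \<open>k + 1\<close> lie between 2 and \<open>p - 1\<close>, where the filtration is
    constant.\<close>
  have "V k = V (Suc k)" using V_eq_normJ assms k by simp
  then have "fam_basis p (V k) (V (Suc k)) {} (\<lambda>x::unit. 1)" using Q.fam_basis_empty_iff by blast
  then have "Kset (Suc k) \<approx> ({} :: unit set)" using assms k by (intro Kset_eqpoll) auto
  then show ?thesis using k by simp
qed

lemma xiN_eq_normK:
  assumes "xi \<in> normK p s"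
  shows "xiN = normK p s"
proof
  show "xiN \<subseteq> normK p s"
    using mult_subgroupD(3)[OF mult_subgroup_normK] mult_subgroup_power[OF mult_subgroup_normK assms]
    by (auto simp: xiN_def)
qed (rule normK_xiN)

text \<open>For odd \<open>p\<close>, \<open>V 1\<close> modulo \<open>V 2\<close> is generated by
  the class of \<open>xi\<close>, which is trivial exactly when \<open>xi\<close> is a norm.\<close>

lemma Kset_2:
  assumes "p > 2"
  shows "finite (Kset 2)" "card (Kset 2) = 1 - Upsilon p s xi"
proof -
  have odd: "odd p" using prime_odd_nat[OF prime_p] assms by linarith
  have V2: "V (Suc 1) = normJ_pre p s" using V_eq_normJ[of 2] assms by (simp add: numeral_2_eq_2)
  interpret Q: Fp_quotient p "V 1" "V (Suc 1)" by (rule Fp_quotient_V) simp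
  have basis0: "fam_basis p (V (Suc 1)) (V (Suc 1)) {} (\<lambda>x::unit. 1)"
    by (rule iffD2[OF Fp_quotient.fam_basis_empty_iff[OF Fp_quotient_V[OF order_refl]]]) simp
  have "finite (Kset (Suc 1)) \<and> card (Kset (Suc 1)) = 1 - Upsilon p s xi"
  proof (cases "xi \<in> normK p s")
    case True
    have "V 1 = V (Suc 1)"
      unfolding V1_eq V2 xiN_eq_normK[OF True] normJ_pre_eq normK_eq by blast
    then have "fam_basis p (V 1) (V (Suc 1)) {} (\<lambda>x::unit. 1)" using Q.fam_basis_empty_iff by blast
    then have "Kset (Suc 1) \<approx> ({} :: unit set)" using assms by (intro Kset_eqpoll) auto
    then show ?thesis using True by (simp add: Upsilon_def)
  next
    case False
    have "fam_basis p (V 1) (V (Suc 1)) (({} :: unit set) <+> {()}) (case_sum (\<lambda>x. 1) (\<lambda>_. xi))"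
    proof (rule Q.fam_basis_subspace_adjoin[OF basis0 mult_subgroup_V order_refl Q.H_U xi_V1])
      show "xi \<notin> V (Suc 1)" unfolding V2 by (rule xi_not_in_normJ[OF odd False])
      fix u assume "u \<in> V 1"
      then obtain h c y where "h \<in> normK p s" "y \<in> P" "u = h * xi ^ c * y" unfolding V1_eq xiN_def by blast
      then have "h * y \<in> V (Suc 1)" "u = (h * y) * xi ^ c" unfolding V2 using normJ_I by (auto simp: mult_ac)
      then show "\<exists>v\<in>V (Suc 1). \<exists>n. u = v * xi ^ n" by blast
    qed
    then have "Kset (Suc 1) \<approx> (({} :: unit set) <+> {()})" using assms by (intro Kset_eqpoll) auto
    then have "finite (Kset (Suc 1)) \<and> card (Kset (Suc 1)) = card (({} :: unit set) <+> {()})"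
      using eqpoll_finite_iff eqpoll_iff_card by (metis finite_Plus finite.emptyI finite.insertI)
    then show ?thesis using False by (simp add: Upsilon_def card_Plus)
  qed
  then show "finite (Kset 2)" "card (Kset 2) = 1 - Upsilon p s xi" by (simp_all add: numeral_2_eq_2)
qed

text \<open>If \<open>xi\<close> is a norm, \<open>V 0\<close> modulo \<open>V 1\<close> has one
  dimension more than \<open>F - {0}\<close> modulo norms, and the unit on the left makes two.
  Otherwise it is \<open>F - {0}\<close> modulo \<open>xiN\<close>, and the unit on the left matches
  the class of \<open>xi\<close>. Disjoint sums express this for all cardinals.\<close>

lemma Kset_1:
  assumes "Fp_basis p (F - {0}) (normK p s) B"
  shows "Kset 1 <+> {()} \<approx> {..<2 * Upsilon p s xi} <+> B"
proof (cases "xi \<in> normK p s")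
  case True
  have B: "fam_basis p (F - {0}) (normK p s) B (\<lambda>x. x)" by (rule FN.Fp_basis_fam_basis[OF assms])
  obtain x0 where x0: "x0 \<in> V 0" "\<not> (\<exists>f\<in>F - {0}. \<exists>z\<in>P. x0 = f * z)"
    "\<And>x. x \<in> V 0 \<Longrightarrow> \<exists>f\<in>F - {0}. \<exists>z\<in>P. \<exists>n. x = f * z * x0 ^ n"
    using V0_if_xi_norm[OF True] by blast
  \<comment> \<open>The part of \<open>V 0\<close> with trivial obstruction; \<open>x0\<close>
    generates \<open>V 0\<close> over it.\<close>
  define FP where "FP = {f * z | f z. f \<in> F - {0} \<and> z \<in> P}"
  interpret Q: Fp_quotient p "V 0" "V (Suc 0)" by (rule Fp_quotient_V) simp
  have FP_sub: "mult_subgroup FP"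
    unfolding mult_subgroup_def
  proof (intro conjI ballI)
    show "1 \<in> FP" unfolding FP_def using F_closed(2) P_1 by force
    show "0 \<notin> FP" unfolding FP_def using P_ne0 by auto
  next
    fix x y assume "x \<in> FP" "y \<in> FP"
    then obtain f z f' z' where *: "f \<in> F - {0}" "z \<in> P" "x = f * z" "f' \<in> F - {0}" "z' \<in> P" "y = f' * z'"
      unfolding FP_def by blast
    then have "x * y = (f * f') * (z * z')" by (simp add: mult_ac)
    then show "x * y \<in> FP" unfolding FP_def using * P_mult mult_subgroupD(3)[OF mult_subgroup_F] by blast
  next
    fix x assume "x \<in> FP"
    then obtain f z where *: "f \<in> F - {0}" "z \<in> P" "x = f * z" unfolding FP_def by blast
    then have "inverse x = inverse f * inverse z" by simp
    then show "inverse x \<in> FP"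
      unfolding FP_def using * mult_subgroupD(4)[OF mult_subgroup_P] mult_subgroupD(4)[OF mult_subgroup_F] by blast
  qed
  have N: "xiN = normK p s" by (rule xiN_eq_normK[OF True])
  have V1FP: "V 1 \<subseteq> FP" unfolding V1_eq FP_def using xiN_F by blast
  have FPV0: "FP \<subseteq> V 0"
    unfolding FP_def using F_V0 P_subset_V[of 0] mult_subgroupD(3)[OF mult_subgroup_V] by blast
  have FFP: "F - {0} \<subseteq> FP" unfolding FP_def using P_1 by force
  \<comment> \<open>Since \<open>xi\<close> is a norm, \<open>xiN\<close> is the group of norms, so
    \<open>F\<close> meets \<open>V 1\<close> only in norms and the basis \<open>B\<close> carries
    over.\<close>
  have "fam_basis p FP (V 1) B (\<lambda>x. x)"
  proof (rule FN.fam_basis_iso[OF B _ FFP mult_subgroup_V])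
    show "normK p s \<subseteq> V 1" using xiN_V1 N by simp
    show "(F - {0}) \<inter> V 1 \<subseteq> normK p s" using F_inter_V1 N by simp
    show "\<exists>v\<in>F - {0}. \<exists>h\<in>V 1. u = v * h" if "u \<in> FP" for u
      using that P_subset_V[of 1] unfolding FP_def by blast
  qed
  then have "fam_basis p (V 0) (V (Suc 0)) (B <+> {()}) (case_sum (\<lambda>x. x) (\<lambda>_. x0))"
    unfolding One_nat_def
  proof (rule Q.fam_basis_subspace_adjoin[OF _ FP_sub _ FPV0 x0(1)])
    show "V (Suc 0) \<subseteq> FP" using V1FP by simp
    show "x0 \<notin> FP" using x0(2) unfolding FP_def by blast
    fix u assume "u \<in> V 0"
    then obtain f z n where "f \<in> F - {0}" "z \<in> P" "u = f * z * x0 ^ n" using x0(3) by blast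
    then show "\<exists>v\<in>FP. \<exists>n. u = v * x0 ^ n" unfolding FP_def by blast
  qed
  then have "Kset 1 \<approx> B <+> {()}" using Kset_eqpoll[of 0] p_pos by simp
  then have "Kset 1 <+> {()} \<approx> (B <+> {()}) <+> {()}" by (intro sum_eqpoll_cong) auto
  also have "(B <+> {()}) <+> {()} \<approx> {..<2 :: nat} <+> B"
    unfolding eqpoll_def
  proof (rule exI, rule bij_betw_byWitness)
    let ?f = "case_sum (case_sum Inr (\<lambda>_. Inl (0::nat))) (\<lambda>_. Inl 1)"
    let ?g = "case_sum (\<lambda>n. if n = (0::nat) then Inl (Inr ()) else Inr ()) (\<lambda>b. Inl (Inl b))"
    show "\<forall>x\<in>(B <+> {()}) <+> {()}. ?g (?f x) = x" by auto
    show "\<forall>y\<in>{..<2} <+> B. ?f (?g y) = y" by auto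
    show "?f ` ((B <+> {()}) <+> {()}) \<subseteq> {..<2} <+> B" by auto
    show "?g ` ({..<2} <+> B) \<subseteq> (B <+> {()}) <+> {()}" by auto
  qed
  finally show ?thesis using True by (simp add: Upsilon_def)
next
  case False
  interpret Q: Fp_quotient p "V 0" "V (Suc 0)" by (rule Fp_quotient_V) simp
  let ?b = "\<lambda>j. (tau ^^ 0) (gen (Suc 0) j)"
  have b: "fam_basis p (V 0) (V (Suc 0)) (Kset (Suc 0)) ?b" by (rule V_fam_basis[OF p_pos])
  \<comment> \<open>All obstructions vanish here, so each basis class has a representative in
    \<open>F\<close>.\<close>
  have "\<exists>f\<in>F - {0}. \<exists>z\<in>P. ?b j = f * z" if "j \<in> Kset (Suc 0)" for j
    using V0_if_xi_not_norm[OF False fam_basisD(1)[OF b that]] by blast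
  then obtain f where f: "\<And>j. j \<in> Kset (Suc 0) \<Longrightarrow> f j \<in> F - {0} \<and> (\<exists>z\<in>P. ?b j = f j * z)" by metis
  have "fam_basis p (V 0) (V (Suc 0)) (Kset (Suc 0)) f"
  proof (rule Q.fam_basis_change[OF b])
    fix j assume j: "j \<in> Kset (Suc 0)"
    show "f j \<in> V 0" using f[OF j] F_V0 by blast
    obtain z where "z \<in> P" "?b j = f j * z" using f[OF j] by blast
    then show "?b j / f j \<in> V (Suc 0)" using f[OF j] P_subset_V by auto
  qed
  then have "fam_basis p (F - {0}) xiN (Kset (Suc 0)) f"
    using f F_V0 xiN_V1 F_inter_V1 by (intro FxiN.fam_basis_restrict[of "V 0" "V (Suc 0)"]) auto
  \<comment> \<open>Passing from \<open>xiN\<close> down to the norms adds the one class of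
    \<open>xi\<close>, which is not a norm.\<close>
  then have "fam_basis p (F - {0}) (normK p s) (Kset (Suc 0) <+> {()}) (case_sum f (\<lambda>_. xi))"
    unfolding xiN_def using False xi_F xi_ne0 by (intro FN.fam_basis_quotient_adjoin) auto
  then have "Kset 1 <+> {()} \<approx> B"
    using FN.fam_basis_eqpoll FN.Fp_basis_fam_basis[OF assms] by simp
  also have "B \<approx> {..<0 :: nat} <+> B"
    unfolding eqpoll_def by (rule exI[of _ Inr]) (auto simp: bij_betw_def)
  finally show ?thesis using False by (simp add: Upsilon_def)
qed

end

theorem theorem3:
  fixes p :: nat and F :: "'k::field set" and xi a alpha :: 'k and sigma :: "'k \<Rightarrow> 'k"
    and Kset :: "nat \<Rightarrow> 'j set" and M :: "nat \<Rightarrow> 'j \<Rightarrow> 'k set"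
  assumes "prime p"
    and "of_nat p \<noteq> (0::'k)"
    and "is_subfield F"
    and "xi \<in> F" and "primitive_root p xi"
    and "a \<in> F" and "a \<noteq> 0" and "\<forall>b\<in>F. b ^ p \<noteq> a"
    and "alpha ^ p = a"
    and "\<forall>L. is_subfield L \<and> F \<subseteq> L \<and> alpha \<in> L \<longrightarrow> L = UNIV"
    and "field_aut sigma" and "\<forall>x\<in>F. sigma x = x" and "sigma alpha = xi * alpha"
    and "Jdecomp p sigma Kset M"
  shows "(\<forall>B. Fp_basis p (F - {0}) (normK p sigma) B \<longrightarrow>
            (\<exists>f. bij_betw f (Kset 1 <+> {()}) ({..<2 * Upsilon p sigma xi} <+> B)))
       \<and> (p > 2 \<longrightarrow> finite (Kset 2) \<and> card (Kset 2) = 1 - Upsilon p sigma xi)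
       \<and> (\<forall>i. 3 \<le> i \<and> i \<le> p - 1 \<longrightarrow> Kset i = {})
       \<and> (\<forall>B. Fp_basis p (normJ_pre p sigma) (pth p) B \<longrightarrow> (\<exists>f. bij_betw f (Kset p) B))"
proof -
  interpret kummer_decomposition p F xi a alpha sigma Kset M
    using assms by unfold_locales auto
  show ?thesis
    using Kset_1 Kset_2 Kset_middle Kset_p unfolding eqpoll_def by (intro conjI allI impI) blast+
qed

end
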